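(* Let $\omega,\Phi_0,\tilde t\in\mathbb{R}$ be constants and consider, for a small parameter $\varepsilon>0$, the equation $$u''+2u-2u^3=\varepsilon\cos(\omega t+\Phi_0). \qquad ( * )$$ There exists a two-parameter asymptotic solution of $( * )$ of the form $$U(t,\varepsilon)=\sum_{n=0}^{\infty}\varepsilon^nU_n(t),\qquad U_0(t)=\tanh(t+\tilde t),$$ when $$\tfrac12\ln\varepsilon\ll t\ll-\tfrac12\ln\varepsilon .$$ The higher-order terms ($n\ge1$) are $$U_n(t)=A_n^-e^{2t}+B_n^-e^{-2t}+W_n^-(t)\quad\text{as } t\to-\infty,\qquad W_n^-(t)=O(e^{-2nt}),\quad t\to-\infty,$$ where $A_n^-,B_n^-$ are constants and $W_n^-$ has an asymptotic expansion into a series of powers of $e^{t}$ as $t\to-\infty$ which does not contain terms $C_1e^{2t}$ and $C_2e^{-2t}$ with constants $C_1,C_2$. This means that all parameters of $U_n$ are $A_n^-$ and $B_n^-$. Therefore the parameters of the asymptotic solution are $$A^-=\sum_{n=1}^\infty\varepsilon^nA_n^-,\qquad B^-=\sum_{n=1}^\infty\varepsilon^nB_n^- .$$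
   Context: Asymptotic solution: the (formal) series $U(t,\varepsilon)=\sum_{n\ge0}\varepsilon^nU_n(t)$ is called an asymptotic solution of $( * )$ if there is a constant $\varepsilon_0>0$ such that, for $\varepsilon\in(0,\varepsilon_0)$, substituting $U(t,\varepsilon)$ into $( * )$ gives a residual that is $o(\varepsilon^n)$ for every $n\in\mathbb{N}$. Range: the expansion is regarded as valid as long as $\varepsilon U_{n+1}/U_n\ll1$, which gives $\varepsilon e^{2|t|}\ll1$. The range $\tfrac12\ln\varepsilon\ll t\ll-\tfrac12\ln\varepsilon$ is understood in this sense: $\varepsilon e^{2|t|}\to0$ as $\varepsilon\to0$, that is, $-\tfrac12\ln\varepsilon-|t|\to+\infty$. Expansion of $W_n^-$: the coefficients of the powers of $e^t$ are in general finite linear combinations of $t^l\cos(m\omega t)$ and $t^l\sin(m\omega t)$ with integers $l,m\ge0$. The excluded terms $C_1e^{2t}$, $C_2e^{-2t}$ are those with pure constant coefficient ($l=m=0$). *)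

theory Defs
  imports "HOL-Analysis.Analysis" "HOL-Library.Landau_Symbols"
begin

definition residual :: "real \<Rightarrow> real \<Rightarrow> real \<Rightarrow> (real \<Rightarrow> real) \<Rightarrow> real \<Rightarrow> real" where
  "residual \<omega> \<Phi>\<^sub>0 \<epsilon> u t =
     deriv (deriv u) t + 2 * u t - 2 * (u t) ^ 3 - \<epsilon> * cos (\<omega> * t + \<Phi>\<^sub>0)"

definition partial_sum :: "(nat \<Rightarrow> real \<Rightarrow> real) \<Rightarrow> nat \<Rightarrow> real \<Rightarrow> real \<Rightarrow> real" where
  "partial_sum U N \<epsilon> t = (\<Sum>n\<le>N. \<epsilon> ^ n * U n t)"

text \<open>
  The formal series is represented by its coefficient functions. Its residual is a formal
  series in the small parameter as well; it is \<open>o(\<epsilon>\<^sup>n)\<close> if, at every \<open>t\<close>, the residual of the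
  partial sum of order \<open>n\<close> is \<open>o(\<epsilon>\<^sup>n)\<close>, since the omitted terms only contribute \<open>O(\<epsilon>\<^sup>n\<^sup>+\<^sup>1)\<close>.
\<close>

definition asymptotic_solution :: "real \<Rightarrow> real \<Rightarrow> (nat \<Rightarrow> real \<Rightarrow> real) \<Rightarrow> bool" where
  "asymptotic_solution \<omega> \<Phi>\<^sub>0 U \<longleftrightarrow>
     (\<forall>n t. U n differentiable (at t) \<and> deriv (U n) differentiable (at t)) \<and>
     (\<exists>\<epsilon>\<^sub>0>0. \<forall>n t.
        (\<lambda>\<epsilon>. residual \<omega> \<Phi>\<^sub>0 \<epsilon> (partial_sum U n \<epsilon>) t)
          \<in> o[at 0 within {0<..<\<epsilon>\<^sub>0}](\<lambda>\<epsilon>. \<epsilon> ^ n))"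

definition kink_solution :: "real \<Rightarrow> real \<Rightarrow> real \<Rightarrow> (nat \<Rightarrow> real \<Rightarrow> real) \<Rightarrow> bool" where
  "kink_solution \<omega> \<Phi>\<^sub>0 s U \<longleftrightarrow>
     asymptotic_solution \<omega> \<Phi>\<^sub>0 U \<and> (\<forall>t. U 0 t = tanh (t + s))"

text \<open>
  The regime \<open>\<epsilon> * exp (2 * \<bar>t\<bar>) \<rightarrow> 0\<close> with \<open>\<epsilon> > 0\<close>, as a filter on pairs \<open>(t, \<epsilon>)\<close>. Since
  \<open>ln (\<epsilon> * exp (2 * \<bar>t\<bar>)) = -2 * (- (ln \<epsilon>) / 2 - \<bar>t\<bar>)\<close>, it is the regime
  \<open>- (ln \<epsilon>) / 2 - \<bar>t\<bar> \<rightarrow> \<infinity>\<close>, and it forces \<open>\<epsilon> \<rightarrow> 0\<close>.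
\<close>

definition validity_range :: "(real \<times> real) filter" where
  "validity_range = filtercomap (\<lambda>(t, \<epsilon>). \<epsilon> * exp (2 * \<bar>t\<bar>)) (at_right 0)"

text \<open>
  Uniformly in this regime the successive terms are ordered by the gauges
  \<open>(\<epsilon> * exp (2 * \<bar>t\<bar>)) ^ n\<close>, each negligible against its predecessor. (Quotients
  \<open>\<epsilon> * U (n + 1) t / U n t\<close> would be meaningless near zeros of \<open>U n\<close>.) For \<open>t\<close> in a bounded
  set the gauges are those of the powers of \<open>\<epsilon>\<close>.
\<close>

definition valid_in_range :: "real \<Rightarrow> real \<Rightarrow> (nat \<Rightarrow> real \<Rightarrow> real) \<Rightarrow> bool" where
  "valid_in_range \<omega> \<Phi>\<^sub>0 U \<longleftrightarrow> (\<forall>n.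
     (\<lambda>(t, \<epsilon>). \<epsilon> ^ n * U n t)
       \<in> O[validity_range](\<lambda>(t, \<epsilon>). (\<epsilon> * exp (2 * \<bar>t\<bar>)) ^ n) \<and>
     (\<lambda>(t, \<epsilon>). residual \<omega> \<Phi>\<^sub>0 \<epsilon> (partial_sum U n \<epsilon>) t)
       \<in> o[validity_range](\<lambda>(t, \<epsilon>). (\<epsilon> * exp (2 * \<bar>t\<bar>)) ^ n))"

text \<open>
  \<open>trig_coeff \<omega> q c\<close>: the function \<open>q\<close> is a finite linear combination of \<open>t ^ l * cos (m * \<omega> * t)\<close>
  and \<open>t ^ l * sin (m * \<omega> * t)\<close> whose constant term is \<open>c\<close>. For \<open>\<omega> \<noteq> 0\<close> this is the coefficient
  with \<open>l = m = 0\<close>; for \<open>\<omega> = 0\<close> every \<open>cos (m * \<omega> * t)\<close> is the constant 1, so that all of the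
  coefficients with \<open>l = 0\<close> contribute.
\<close>

definition trig_coeff :: "real \<Rightarrow> (real \<Rightarrow> real) \<Rightarrow> real \<Rightarrow> bool" where
  "trig_coeff \<omega> q c \<longleftrightarrow> (\<exists>(d::nat) (a :: nat \<Rightarrow> nat \<Rightarrow> real) (b :: nat \<Rightarrow> nat \<Rightarrow> real).
     (\<forall>t. q t = (\<Sum>l\<le>d. \<Sum>m\<le>d.
        t ^ l * (a l m * cos (real m * \<omega> * t) + b l m * sin (real m * \<omega> * t)))) \<and>
     c = (\<Sum>m | m \<le> d \<and> real m * \<omega> = 0. a 0 m))"

text \<open>
  An asymptotic expansion in integer powers of \<open>exp t\<close> as \<open>t \<rightarrow> -\<infinity>\<close>, with only finitely many
  negative powers and without constant multiples of \<open>exp (2 * t)\<close> and \<open>exp (- 2 * t)\<close>.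
\<close>

definition expansion_without_exp2 :: "real \<Rightarrow> (real \<Rightarrow> real) \<Rightarrow> bool" where
  "expansion_without_exp2 \<omega> W \<longleftrightarrow>
     (\<exists>(k\<^sub>0::int) (q :: int \<Rightarrow> real \<Rightarrow> real) (c :: int \<Rightarrow> real).
        (\<forall>k. trig_coeff \<omega> (q k) (c k)) \<and> c 2 = 0 \<and> c (- 2) = 0 \<and>
        (\<forall>N. (\<lambda>t. W t - (\<Sum>k=k\<^sub>0..N. q k t * exp (of_int k * t)))
               \<in> o[at_bot](\<lambda>t. exp (of_int N * t))))"

definition left_form :: "real \<Rightarrow> nat \<Rightarrow> real \<Rightarrow> real \<Rightarrow> (real \<Rightarrow> real) \<Rightarrow> bool" where
  "left_form \<omega> n A B u \<longleftrightarrow> (\<exists>W.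
     (\<forall>\<^sub>F t in at_bot. u t = A * exp (2 * t) + B * exp (- 2 * t) + W t) \<and>
     W \<in> O[at_bot](\<lambda>t. exp (- 2 * real n * t)) \<and>
     expansion_without_exp2 \<omega> W)"

text \<open>
  The parameters of a solution are two formal power series in the small parameter without
  constant term.
\<close>

definition left_parameters ::
    "real \<Rightarrow> (nat \<Rightarrow> real \<Rightarrow> real) \<Rightarrow> real fps \<Rightarrow> real fps \<Rightarrow> bool" where
  "left_parameters \<omega> U A B \<longleftrightarrow>
     fps_nth A 0 = 0 \<and> fps_nth B 0 = 0 \<and>
     (\<forall>n\<ge>1. left_form \<omega> n (fps_nth A n) (fps_nth B n) (U n))"

end

theory Submission
  imports Defs "HOL-Real_Asymp.Real_Asymp"
begin

text \<open>
  Linearising at the kink \<open>T = tanh (t + s)\<close> gives \<open>v'' = (6 T\<^sup>2 - 2) v\<close>, with the solutions \<open>1 - T\<^sup>2\<close>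
  (the translation mode, decaying like \<open>exp (- 2 * \<bar>t\<bar>)\<close>) and a second one growing like
  \<open>exp (2 * \<bar>t\<bar>)\<close>. Order \<open>n\<close> of the formal series solves this equation with a forcing built from
  the lower orders, so by variation of constants it grows at most like \<open>exp (2 * n * \<bar>t\<bar>)\<close>.

  Functions which to every order are exponential polynomials in \<open>t\<close> form a ring that is closed under
  antiderivatives; hence variation of constants stays inside this class. The coefficients of such an
  expansion are unique, because a quasi-polynomial that tends to 0 at \<open>-\<infinity>\<close> vanishes. The pure constant
  coefficients of \<open>exp (2 * t)\<close> and \<open>exp (- 2 * t)\<close> are therefore linear functionals on solutions,
  and they are linearly independent on the two homogeneous solutions, so they determine the
  solution at each order and can be prescribed.
\<close>

section \<open>Quasi-polynomial coefficients\<close>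

text \<open>Two descriptions of an expansion are used because neither serves alone.
  \<open>has_expansion\<close> names the coefficients, so that they can be compared, but a product
  would require multiplying out two coefficient families. \<open>expandable\<close> asks for one
  exponential polynomial per order, with no link between the orders; products and antiderivatives
  then reduce to remainder estimates, and uniqueness recovers the coefficients. The growth bound
  meets a resonance: forcing that grows exactly like \<open>exp (2 * \<bar>t\<bar>)\<close>, paired
  with the decaying solution, gives a merely bounded integrand, whose integral may grow linearly.
  Order 1 escapes because the cubic part of its forcing vanishes and only the bounded cosine
  remains; at later orders the rate 2 * n exceeds 2. At fixed t the residual of a partial sum is a
  polynomial in \<epsilon>, so the order condition says that its coefficients up to n vanish. The
  surviving coefficients contain no derivative of U, hence growth bounds on the U n alone control
  the residual in the range.\<close>

lemma power_times_exp_at_bot: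
  fixes r :: real
  assumes "0 < r"
  shows "((\<lambda>t. t ^ l * exp (r * t)) \<longlongrightarrow> 0) at_bot"
proof -
  have "((\<lambda>x. x ^ l * exp (- r * x)) \<longlongrightarrow> 0) at_top"
    using assms by real_asymp
  then have "((\<lambda>x. (- 1) ^ l * (x ^ l * exp (- r * x))) \<longlongrightarrow> (- 1) ^ l * 0) at_top"
    by (intro tendsto_mult tendsto_const)
  moreover have "(- 1) ^ l * (x ^ l * exp (- r * x)) = (- x) ^ l * exp (r * (- x))" for x :: real
    by (simp flip: power_mult_distrib)
  ultimately show ?thesis
    by (simp only: at_bot_mirror filterlim_filtermap mult_zero_right)
qed

lemma exp_smallo_at_bot:
  assumes "r < (r' :: real)"
  shows "(\<lambda>t. exp (r' * t)) \<in> o[at_bot](\<lambda>t. exp (r * t))"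
proof (rule smalloI_tendsto)
  have "((\<lambda>t. t ^ 0 * exp ((r' - r) * t)) \<longlongrightarrow> 0) at_bot"
    by (rule power_times_exp_at_bot) (use assms in simp)
  then show "((\<lambda>t. exp (r' * t) / exp (r * t)) \<longlongrightarrow> 0) at_bot"
    by (simp add: exp_diff left_diff_distrib)
qed simp

lemma exp_bigo_at_bot:
  assumes "r \<le> (r' :: real)"
  shows "(\<lambda>t. exp (r' * t)) \<in> O[at_bot](\<lambda>t. exp (r * t))"
  using exp_smallo_at_bot[of r r'] assms landau_o.small_imp_big by (cases "r = r'") auto

lemma trig_coeff_tendsto:
  assumes "trig_coeff \<omega> q c" "0 < r"
  shows "((\<lambda>t. q t * exp (r * t)) \<longlongrightarrow> 0) at_bot"
proof -
  from assms(1) obtain d a b where q: "\<And>t. q t = (\<Sum>l\<le>d. \<Sum>m\<le>d.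
        t ^ l * (a l m * cos (real m * \<omega> * t) + b l m * sin (real m * \<omega> * t)))"
    unfolding trig_coeff_def by blast
  have *: "((\<lambda>t. t ^ l * (a l m * cos (real m * \<omega> * t) + b l m * sin (real m * \<omega> * t))
             * exp (r * t)) \<longlongrightarrow> 0) at_bot" for l m
  proof (rule Lim_null_comparison)
    show "\<forall>\<^sub>F t in at_bot. norm (t ^ l * (a l m * cos (real m * \<omega> * t) + b l m * sin (real m * \<omega> * t))
             * exp (r * t)) \<le> (\<bar>a l m\<bar> + \<bar>b l m\<bar>) * \<bar>t ^ l * exp (r * t)\<bar>"
    proof (intro always_eventually allI)
      fix t
      have "\<bar>a l m * cos (real m * \<omega> * t) + b l m * sin (real m * \<omega> * t)\<bar>
              \<le> \<bar>a l m\<bar> * 1 + \<bar>b l m\<bar> * 1"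
        by (rule order_trans[OF abs_triangle_ineq], unfold abs_mult)
          (intro add_mono mult_left_mono; simp)
      from mult_right_mono[OF this, of "\<bar>t ^ l * exp (r * t)\<bar>"]
      show "norm (t ^ l * (a l m * cos (real m * \<omega> * t) + b l m * sin (real m * \<omega> * t))
             * exp (r * t)) \<le> (\<bar>a l m\<bar> + \<bar>b l m\<bar>) * \<bar>t ^ l * exp (r * t)\<bar>"
        by (simp add: abs_mult mult_ac)
    qed
    show "((\<lambda>t. (\<bar>a l m\<bar> + \<bar>b l m\<bar>) * \<bar>t ^ l * exp (r * t)\<bar>) \<longlongrightarrow> 0) at_bot"
      using tendsto_mult_right_zero[OF tendsto_rabs_zero[OF power_times_exp_at_bot[OF assms(2)]]]
      by simp
  qed
  show ?thesis
    unfolding q sum_distrib_right by (intro tendsto_null_sum *)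
qed

text \<open>Adding two quasi-polynomials needs a common bound on the indices. Padding with zeros
  provides every larger bound, for the values and for the constant term with the same
  arrays.\<close>

lemma trig_coeff_padE:
  assumes "trig_coeff \<omega> q c"
  obtains d a b where "\<And>D t. d \<le> D \<Longrightarrow> q t = (\<Sum>l\<le>D. \<Sum>m\<le>D.
        t ^ l * (a l m * cos (real m * \<omega> * t) + b l m * sin (real m * \<omega> * t)))"
    "\<And>D. d \<le> D \<Longrightarrow> c = (\<Sum>m | m \<le> D \<and> real m * \<omega> = 0. a 0 m)"
proof -
  from assms obtain d a b where q: "\<And>t. q t = (\<Sum>l\<le>d. \<Sum>m\<le>d.
        t ^ l * (a l m * cos (real m * \<omega> * t) + b l m * sin (real m * \<omega> * t)))"
    and c: "c = (\<Sum>m | m \<le> d \<and> real m * \<omega> = 0. a 0 m)"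
    unfolding trig_coeff_def by blast
  define a' where "a' l m = (if l \<le> d \<and> m \<le> d then a l m else 0)" for l m
  define b' where "b' l m = (if l \<le> d \<and> m \<le> d then b l m else 0)" for l m
  show ?thesis
  proof
    fix D t assume D: "d \<le> D"
    show "q t = (\<Sum>l\<le>D. \<Sum>m\<le>D.
        t ^ l * (a' l m * cos (real m * \<omega> * t) + b' l m * sin (real m * \<omega> * t)))"
      unfolding q sum.cartesian_product
      by (rule sum.mono_neutral_cong_left) (use D in \<open>auto simp: a'_def b'_def split: if_splits\<close>)
    show "c = (\<Sum>m | m \<le> D \<and> real m * \<omega> = 0. a' 0 m)"
      unfolding c
      by (rule sum.mono_neutral_cong_left) (use D in \<open>auto simp: a'_def\<close>)
  qed
qed

lemma trig_coeff_add:
  assumes "trig_coeff \<omega> q c" "trig_coeff \<omega> q' c'"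
  shows "trig_coeff \<omega> (\<lambda>t. q t + q' t) (c + c')"
proof -
  from assms(1) obtain d a b where 1: "\<And>D t. d \<le> D \<Longrightarrow> q t = (\<Sum>l\<le>D. \<Sum>m\<le>D.
        t ^ l * (a l m * cos (real m * \<omega> * t) + b l m * sin (real m * \<omega> * t)))"
    "\<And>D. d \<le> D \<Longrightarrow> c = (\<Sum>m | m \<le> D \<and> real m * \<omega> = 0. a 0 m)"
    by (rule trig_coeff_padE) blast
  from assms(2) obtain d' a' b' where 2: "\<And>D t. d' \<le> D \<Longrightarrow> q' t = (\<Sum>l\<le>D. \<Sum>m\<le>D.
        t ^ l * (a' l m * cos (real m * \<omega> * t) + b' l m * sin (real m * \<omega> * t)))"
    "\<And>D. d' \<le> D \<Longrightarrow> c' = (\<Sum>m | m \<le> D \<and> real m * \<omega> = 0. a' 0 m)"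
    by (rule trig_coeff_padE) blast
  define D where "D = max d d'"
  have D: "d \<le> D" "d' \<le> D" by (simp_all add: D_def)
  show ?thesis
    unfolding trig_coeff_def
  proof (intro exI conjI allI)
    show "q t + q' t = (\<Sum>l\<le>D. \<Sum>m\<le>D. t ^ l * ((\<lambda>l m. a l m + a' l m) l m * cos (real m * \<omega> * t)
            + (\<lambda>l m. b l m + b' l m) l m * sin (real m * \<omega> * t)))" for t
      unfolding 1(1)[OF D(1)] 2(1)[OF D(2)]
      by (simp add: sum.distrib[symmetric] algebra_simps)
    show "c + c' = (\<Sum>m | m \<le> D \<and> real m * \<omega> = 0. (\<lambda>l m. a l m + a' l m) 0 m)"
      unfolding 1(2)[OF D(1)] 2(2)[OF D(2)] by (simp add: sum.distrib)
  qed
qed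

lemma trig_coeff_scale:
  assumes "trig_coeff \<omega> q c"
  shows "trig_coeff \<omega> (\<lambda>t. r * q t) (r * c)"
proof -
  from assms obtain d a b where q: "\<And>t. q t = (\<Sum>l\<le>d. \<Sum>m\<le>d.
        t ^ l * (a l m * cos (real m * \<omega> * t) + b l m * sin (real m * \<omega> * t)))"
    and c: "c = (\<Sum>m | m \<le> d \<and> real m * \<omega> = 0. a 0 m)"
    unfolding trig_coeff_def by blast
  show ?thesis
    unfolding trig_coeff_def
  proof (intro exI conjI allI)
    show "r * q t = (\<Sum>l\<le>d. \<Sum>m\<le>d. t ^ l * ((\<lambda>l m. r * a l m) l m * cos (real m * \<omega> * t)
            + (\<lambda>l m. r * b l m) l m * sin (real m * \<omega> * t)))" for t
      unfolding q by (simp add: sum_distrib_left algebra_simps)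
    show "r * c = (\<Sum>m | m \<le> d \<and> real m * \<omega> = 0. (\<lambda>l m. r * a l m) 0 m)"
      unfolding c by (simp add: sum_distrib_left)
  qed
qed

lemma trig_coeff_monomial:
  "\<exists>c. trig_coeff \<omega> (\<lambda>t. t ^ l * (\<alpha> * cos (real m * \<omega> * t) + \<beta> * sin (real m * \<omega> * t))) c"
proof -
  define a where "a l' m' = (if l' = l \<and> m' = m then \<alpha> else 0)" for l' m'
  define b where "b l' m' = (if l' = l \<and> m' = m then \<beta> else 0)" for l' m'
  define d where "d = max l m"
  have "t ^ l * (\<alpha> * cos (real m * \<omega> * t) + \<beta> * sin (real m * \<omega> * t)) = (\<Sum>l\<le>d. \<Sum>m\<le>d.
        t ^ l * (a l m * cos (real m * \<omega> * t) + b l m * sin (real m * \<omega> * t)))" for t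
  proof -
    have "(\<Sum>l\<le>d. \<Sum>m\<le>d. t ^ l * (a l m * cos (real m * \<omega> * t) + b l m * sin (real m * \<omega> * t)))
      = (\<Sum>(l', m')\<in>{(l, m)}. t ^ l' * (\<alpha> * cos (real m' * \<omega> * t) + \<beta> * sin (real m' * \<omega> * t)))"
      unfolding sum.cartesian_product
      by (rule sum.mono_neutral_cong_right) (auto simp: a_def b_def d_def split: if_splits)
    then show ?thesis by simp
  qed
  then show ?thesis unfolding trig_coeff_def by blast
qed

lemma trig_coeff_const: "trig_coeff \<omega> (\<lambda>t. r) r"
  unfolding trig_coeff_def
  by (rule exI[of _ 0], rule exI[of _ "\<lambda>l m. r"], rule exI[of _ "\<lambda>l m. 0"])
    (simp add: Collect_conv_if)

text \<open>A nonzero coefficient of positive index would keep the polynomial at least 1 in absolute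
  value near infinity. Once these are excluded, the sequence is constantly
  \<open>p 0\<close>.\<close>

lemma polynomial_tendsto_0:
  fixes p :: "nat \<Rightarrow> real" and x :: "nat \<Rightarrow> real"
  assumes lim: "(\<lambda>n. \<Sum>i\<le>d. p i * x n ^ i) \<longlonglongrightarrow> 0"
    and x: "filterlim x at_infinity sequentially"
  shows "\<forall>i\<le>d. p i = 0"
proof -
  have high: "p i = 0" if "i \<noteq> 0" "i \<le> d" for i
  proof (rule ccontr)
    assume "p i \<noteq> 0"
    then have "\<forall>\<^sub>F z in at_infinity. norm (\<Sum>i\<le>d. p i * z ^ i) \<ge> 1"
      by (intro polyfun_extremal) (use that in blast)
    then have "\<forall>\<^sub>F n in sequentially. norm (\<Sum>i\<le>d. p i * x n ^ i) \<ge> 1"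
      using x by (rule eventually_compose_filterlim)
    moreover have "\<forall>\<^sub>F n in sequentially. norm (\<Sum>i\<le>d. p i * x n ^ i) < 1"
      using tendsto_norm[OF lim] by (intro order_tendstoD) auto
    ultimately have "\<forall>\<^sub>F n :: nat in sequentially. False"
      by eventually_elim linarith
    then show False by simp
  qed
  have "(\<Sum>i\<le>d. p i * x n ^ i) = (\<Sum>i\<in>{0}. p i * x n ^ i)" for n
    by (rule sum.mono_neutral_right) (auto simp: high)
  with lim have "p 0 = 0"
    by (simp add: LIMSEQ_const_iff)
  with high show ?thesis by (metis)
qed

text \<open>Integration over one period \<open>2 * pi / \<omega>\<close> kills every oscillating
  term and leaves \<open>a 0\<close> times the period. \<open>F\<close> is the explicit
  antiderivative; the \<open>b 0\<close> term is absent because its sine is 0.\<close>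

lemma trig_polynomial_mean_0:
  fixes \<omega> :: real
  assumes "\<omega> \<noteq> 0"
    and zero: "\<And>t. (\<Sum>m\<le>d. a m * cos (real m * \<omega> * t) + b m * sin (real m * \<omega> * t)) = 0"
  shows "a 0 = 0"
proof -
  define F where "F t = a 0 * t + (\<Sum>m=1..d. (a m * sin (real m * \<omega> * t) - b m * cos (real m * \<omega> * t))
                         / (real m * \<omega>))" for t
  have "(F has_real_derivative 0) (at t)" for t
  proof -
    have "(F has_real_derivative a 0 +
        (\<Sum>m=1..d. a m * cos (real m * \<omega> * t) + b m * sin (real m * \<omega> * t))) (at t)"
      unfolding F_def
    proof (intro DERIV_add DERIV_sum)
      show "((\<lambda>t. a 0 * t) has_real_derivative a 0) (at t)"
        by (auto intro!: derivative_eq_intros)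
      fix m assume "m \<in> {1..d}"
      then have m: "real m * \<omega> \<noteq> 0" using assms(1) by auto
      define k where "k = real m * \<omega>"
      have "((\<lambda>t. (a m * sin (k * t) - b m * cos (k * t)) / k) has_real_derivative
          (a m * (cos (k * t) * k) + b m * (sin (k * t) * k)) / k) (at t)"
        using m by (auto intro!: derivative_eq_intros simp: k_def)
      also have "(a m * (cos (k * t) * k) + b m * (sin (k * t) * k)) / k =
          a m * cos (k * t) + b m * sin (k * t)"
        using m by (simp add: k_def add_divide_distrib)
      finally show "((\<lambda>t. (a m * sin (real m * \<omega> * t) - b m * cos (real m * \<omega> * t)) / (real m * \<omega>))
          has_real_derivative a m * cos (real m * \<omega> * t) + b m * sin (real m * \<omega> * t)) (at t)"
        by (simp only: k_def)
    qed
    moreover have "{..d} = insert 0 {1..d}" by auto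
    ultimately show ?thesis
      using zero[of t] by simp
  qed
  then have "F (2 * pi / \<omega>) = F 0"
    using DERIV_isconst_all by blast
  moreover have "sin (real m * \<omega> * (2 * pi / \<omega>)) = 0" "cos (real m * \<omega> * (2 * pi / \<omega>)) = 1" for m
  proof -
    have "real m * \<omega> * (2 * pi / \<omega>) = real (2 * m) * pi"
      using assms(1) by simp
    then show "sin (real m * \<omega> * (2 * pi / \<omega>)) = 0" "cos (real m * \<omega> * (2 * pi / \<omega>)) = 1"
      by (simp_all only: sin_npi cos_npi) simp_all
  qed
  ultimately show ?thesis
    using assms(1) by (simp add: F_def)
qed

text \<open>Along \<open>t - j * T\<close>, with \<open>T\<close> a common period of the trigonometric factors, the function is a
  polynomial in \<open>t - j * T\<close>.\<close>

lemma trig_coeff_tendsto_0_imp_0: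
  assumes q: "trig_coeff \<omega> q c" and lim: "(q \<longlongrightarrow> 0) at_bot"
  shows "q = (\<lambda>_. 0)" "c = 0"
proof -
  from q obtain d a b where q: "\<And>t. q t = (\<Sum>l\<le>d. \<Sum>m\<le>d.
        t ^ l * (a l m * cos (real m * \<omega> * t) + b l m * sin (real m * \<omega> * t)))"
    and c: "c = (\<Sum>m | m \<le> d \<and> real m * \<omega> = 0. a 0 m)"
    unfolding trig_coeff_def by blast
  define p where "p l t = (\<Sum>m\<le>d. a l m * cos (real m * \<omega> * t) + b l m * sin (real m * \<omega> * t))" for l t
  have qp: "q t = (\<Sum>l\<le>d. p l t * t ^ l)" for t
    unfolding q p_def by (simp add: sum_distrib_left mult.commute)
  define T where "T = (if \<omega> = 0 then 1 else 2 * pi / \<bar>\<omega>\<bar>)"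
  have T: "T > 0" by (simp add: T_def)
  have per: "cos (real m * \<omega> * (t - real n * T)) = cos (real m * \<omega> * t)"
    "sin (real m * \<omega> * (t - real n * T)) = sin (real m * \<omega> * t)" for m n t
  proof -
    \<comment> \<open>Moving by n periods turns the argument of the m-th factor by m * n full turns,
      in the direction given by the sign of \<omega>. T is built from \<bar>\<omega>\<bar> so that
      the points move to the left.\<close>
    define k :: int where "k = int (m * n) * (if \<omega> = 0 then 0 else if \<omega> > 0 then 1 else - 1)"
    have eq: "real m * \<omega> * (t - real n * T) = real m * \<omega> * t - 2 * pi * of_int k"
      by (auto simp: T_def k_def right_diff_distrib)
    show "cos (real m * \<omega> * (t - real n * T)) = cos (real m * \<omega> * t)"
      "sin (real m * \<omega> * (t - real n * T)) = sin (real m * \<omega> * t)"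
      unfolding eq cos_diff sin_diff cos_int_2pin sin_int_2pin by simp_all
  qed
  have p0: "p l t = 0" if "l \<le> d" for l t
  proof -
    have "filterlim (\<lambda>n. t - real n * T) at_bot sequentially"
      using T by real_asymp
    then have "(\<lambda>n. q (t - real n * T)) \<longlonglongrightarrow> 0"
      by (rule filterlim_compose[OF lim])
    then have "(\<lambda>n. \<Sum>l\<le>d. p l t * (t - real n * T) ^ l) \<longlonglongrightarrow> 0"
      by (simp add: qp p_def per)
    moreover have "filterlim (\<lambda>n. t - real n * T) at_infinity sequentially"
      using T by real_asymp
    ultimately show ?thesis
      using polynomial_tendsto_0[where d = d and p = "\<lambda>l. p l t" and x = "\<lambda>n. t - real n * T"] that
      by blast
  qed
  then show "q = (\<lambda>_. 0)" by (auto simp: qp)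
  \<comment> \<open>For \<omega> = 0 all m contribute to c, and their sum is the value
    \<open>p 0 0\<close>. Otherwise only m = 0 contributes, and its coefficient is the mean of the
    vanishing trigonometric polynomial \<open>p 0\<close>.\<close>
  show "c = 0"
  proof (cases "\<omega> = 0")
    case True
    then show ?thesis using p0[of 0 0] by (simp add: c p_def atMost_def)
  next
    case False
    then have "{m. m \<le> d \<and> real m * \<omega> = 0} = {0}" by auto
    moreover have "a 0 0 = 0"
      by (rule trig_polynomial_mean_0[where a = "a 0" and b = "b 0" and d = d, OF False])
        (use p0[of 0] in \<open>simp add: p_def\<close>)
    ultimately show ?thesis by (simp add: c)
  qed
qed

section \<open>Expansions in powers of \<open>exp t\<close>\<close>

text \<open>Coefficients below \<open>k\<^sub>0\<close> are required to be 0, so that the start of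
  the sum may be lowered freely and c is determined by the function on all integers, not only from
  \<open>k\<^sub>0\<close> on.\<close>

definition has_expansion ::
    "real \<Rightarrow> int \<Rightarrow> (int \<Rightarrow> real \<Rightarrow> real) \<Rightarrow> (int \<Rightarrow> real) \<Rightarrow> (real \<Rightarrow> real) \<Rightarrow> bool" where
  "has_expansion \<omega> k\<^sub>0 q c u \<longleftrightarrow>
     (\<forall>k. trig_coeff \<omega> (q k) (c k)) \<and> (\<forall>k<k\<^sub>0. q k = (\<lambda>_. 0) \<and> c k = 0) \<and>
     (\<forall>N. (\<lambda>t. u t - (\<Sum>k=k\<^sub>0..N. q k t * exp (of_int k * t))) \<in> o[at_bot](\<lambda>t. exp (of_int N * t)))"

lemma has_expansionD:
  assumes "has_expansion \<omega> k\<^sub>0 q c u"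
  shows "trig_coeff \<omega> (q k) (c k)" "k < k\<^sub>0 \<Longrightarrow> q k = (\<lambda>_. 0)" "k < k\<^sub>0 \<Longrightarrow> c k = 0"
    "(\<lambda>t. u t - (\<Sum>k=k\<^sub>0..N. q k t * exp (of_int k * t))) \<in> o[at_bot](\<lambda>t. exp (of_int N * t))"
  using assms by (simp_all add: has_expansion_def)

lemma has_expansion_lower:
  assumes "has_expansion \<omega> k\<^sub>0 q c u" "k\<^sub>1 \<le> k\<^sub>0"
  shows "has_expansion \<omega> k\<^sub>1 q c u"
proof -
  have "(\<Sum>k=k\<^sub>1..N. q k t * exp (of_int k * t)) = (\<Sum>k=k\<^sub>0..N. q k t * exp (of_int k * t))" for N t
    by (rule sum.mono_neutral_right) (use assms in \<open>auto simp: has_expansion_def\<close>)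
  then show ?thesis
    using assms by (auto simp: has_expansion_def)
qed

lemma has_expansion_add:
  assumes "has_expansion \<omega> k\<^sub>0 q c u" "has_expansion \<omega> k\<^sub>1 q' c' v"
  shows "has_expansion \<omega> (min k\<^sub>0 k\<^sub>1) (\<lambda>k t. q k t + q' k t) (\<lambda>k. c k + c' k) (\<lambda>t. u t + v t)"
proof -
  have 1: "has_expansion \<omega> (min k\<^sub>0 k\<^sub>1) q c u" "has_expansion \<omega> (min k\<^sub>0 k\<^sub>1) q' c' v"
    using assms by (auto intro: has_expansion_lower)
  have "(\<lambda>t. u t + v t - (\<Sum>k=min k\<^sub>0 k\<^sub>1..N. (q k t + q' k t) * exp (of_int k * t)))
      \<in> o[at_bot](\<lambda>t. exp (of_int N * t))" for N
  proof -
    have "(\<lambda>t. (u t - (\<Sum>k=min k\<^sub>0 k\<^sub>1..N. q k t * exp (of_int k * t))) +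
               (v t - (\<Sum>k=min k\<^sub>0 k\<^sub>1..N. q' k t * exp (of_int k * t)))) \<in> o[at_bot](\<lambda>t. exp (of_int N * t))"
      by (intro sum_in_smallo has_expansionD[OF 1(1)] has_expansionD[OF 1(2)])
    then show ?thesis by (simp add: algebra_simps sum.distrib)
  qed
  then show ?thesis
    using 1 unfolding has_expansion_def by (auto intro: trig_coeff_add)
qed

lemma has_expansion_scale:
  assumes "has_expansion \<omega> k\<^sub>0 q c u"
  shows "has_expansion \<omega> k\<^sub>0 (\<lambda>k t. r * q k t) (\<lambda>k. r * c k) (\<lambda>t. r * u t)"
proof -
  have "(\<lambda>t. r * u t - (\<Sum>k=k\<^sub>0..N. r * q k t * exp (of_int k * t))) \<in> o[at_bot](\<lambda>t. exp (of_int N * t))"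
    for N
  proof -
    have "(\<lambda>t. r * (u t - (\<Sum>k=k\<^sub>0..N. q k t * exp (of_int k * t)))) \<in> o[at_bot](\<lambda>t. exp (of_int N * t))"
      using has_expansionD(4)[OF assms, of N] by (cases "r = 0") auto
    then show ?thesis by (simp add: algebra_simps sum_distrib_left)
  qed
  then show ?thesis
    using assms unfolding has_expansion_def by (auto intro: trig_coeff_scale)
qed

lemma has_expansion_diff:
  assumes "has_expansion \<omega> k\<^sub>0 q c u" "has_expansion \<omega> k\<^sub>1 q' c' v"
  shows "has_expansion \<omega> (min k\<^sub>0 k\<^sub>1) (\<lambda>k t. q k t - q' k t) (\<lambda>k. c k - c' k) (\<lambda>t. u t - v t)"
  using has_expansion_add[OF assms(1) has_expansion_scale[OF assms(2), of "- 1"]] by simp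

lemma has_expansion_single:
  assumes q: "trig_coeff \<omega> q c"
  shows "has_expansion \<omega> j (\<lambda>k. if k = j then q else (\<lambda>_. 0)) (\<lambda>k. if k = j then c else 0)
           (\<lambda>t. q t * exp (of_int j * t))"
proof -
  have *: "(\<Sum>k=j..N. (if k = j then q else (\<lambda>_. 0)) t * exp (of_int k * t)) =
        (if j \<le> N then q t * exp (of_int j * t) else 0)" for N t
  proof -
    have "(\<Sum>k=j..N. (if k = j then q else (\<lambda>_. 0)) t * exp (of_int k * t)) =
        (\<Sum>k=j..N. if k = j then q t * exp (of_int j * t) else 0)"
      by (intro sum.cong) auto
    then show ?thesis by simp
  qed
  have "(\<lambda>t. q t * exp (of_int j * t)) \<in> o[at_bot](\<lambda>t. exp (of_int N * t))" if "N < j" for N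
  proof (rule smalloI_tendsto)
    have "((\<lambda>t. q t * exp (of_int (j - N) * t)) \<longlongrightarrow> 0) at_bot"
      by (rule trig_coeff_tendsto[OF q]) (use that in simp)
    then show "((\<lambda>t. q t * exp (of_int j * t) / exp (of_int N * t)) \<longlongrightarrow> 0) at_bot"
      by (simp add: exp_diff left_diff_distrib)
  qed simp
  then have "(\<lambda>t. q t * exp (of_int j * t) - (if j \<le> N then q t * exp (of_int j * t) else 0))
      \<in> o[at_bot](\<lambda>t. exp (of_int N * t))" for N
    by (cases "j \<le> N") auto
  then show ?thesis
    unfolding has_expansion_def * using q trig_coeff_const[of \<omega> 0] by simp
qed

text \<open>After division by \<open>exp (of_int k\<^sub>0 * t)\<close> the whole sum still tends to
  0, since \<open>k\<^sub>0 \<le> N\<close>, and so do all terms except the lowest. Hence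
  \<open>q k\<^sub>0\<close> tends to 0, which a quasi-polynomial does only if it vanishes.\<close>

lemma expansion_leading_coeff:
  assumes q: "\<And>k. trig_coeff \<omega> (q k) (c k)"
    and o: "(\<lambda>t. \<Sum>k=k\<^sub>0..N. q k t * exp (of_int k * t)) \<in> o[at_bot](\<lambda>t. exp (of_int N * t))"
    and k: "k\<^sub>0 \<le> N"
  shows "q k\<^sub>0 = (\<lambda>_. 0)" "c k\<^sub>0 = 0"
proof -
  have "((\<lambda>t. (\<Sum>k=k\<^sub>0..N. q k t * exp (of_int k * t)) / exp (of_int N * t) * exp (of_int (N - k\<^sub>0) * t))
     \<longlongrightarrow> 0) at_bot"
  proof (cases "k\<^sub>0 = N")
    case True
    then show ?thesis using smalloD_tendsto[OF o] by simp
  next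
    case False
    then have "((\<lambda>t :: real. t ^ 0 * exp (of_int (N - k\<^sub>0) * t)) \<longlongrightarrow> 0) at_bot"
      by (intro power_times_exp_at_bot) (use k in simp)
    from tendsto_mult[OF smalloD_tendsto[OF o] this] show ?thesis by simp
  qed
  moreover have "((\<lambda>t. \<Sum>k=k\<^sub>0+1..N. q k t * exp (of_int (k - k\<^sub>0) * t)) \<longlongrightarrow> 0) at_bot"
    by (intro tendsto_null_sum trig_coeff_tendsto[OF q]) auto
  ultimately have "((\<lambda>t. (\<Sum>k=k\<^sub>0..N. q k t * exp (of_int k * t)) / exp (of_int N * t) * exp (of_int (N - k\<^sub>0) * t)
      - (\<Sum>k=k\<^sub>0+1..N. q k t * exp (of_int (k - k\<^sub>0) * t))) \<longlongrightarrow> 0 - 0) at_bot"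
    by (rule tendsto_diff)
  moreover have "(\<Sum>k=k\<^sub>0..N. q k t * exp (of_int k * t)) / exp (of_int N * t) * exp (of_int (N - k\<^sub>0) * t)
      - (\<Sum>k=k\<^sub>0+1..N. q k t * exp (of_int (k - k\<^sub>0) * t)) = q k\<^sub>0 t" for t
  proof -
    have *: "exp (of_int k * t) / exp (of_int N * t) * exp (of_int (N - k\<^sub>0) * t) = exp (of_int (k - k\<^sub>0) * t)" for k
      by (simp add: exp_diff left_diff_distrib)
    have "{k\<^sub>0..N} = insert k\<^sub>0 {k\<^sub>0+1..N}" using k by auto
    then have "(\<Sum>k=k\<^sub>0..N. q k t * exp (of_int (k - k\<^sub>0) * t)) =
        q k\<^sub>0 t + (\<Sum>k=k\<^sub>0+1..N. q k t * exp (of_int (k - k\<^sub>0) * t))"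
      by simp
    moreover have "(\<Sum>k=k\<^sub>0..N. q k t * exp (of_int k * t)) / exp (of_int N * t) * exp (of_int (N - k\<^sub>0) * t)
       = (\<Sum>k=k\<^sub>0..N. q k t * (exp (of_int k * t) / exp (of_int N * t) * exp (of_int (N - k\<^sub>0) * t)))"
      unfolding sum_divide_distrib sum_distrib_right by (simp add: mult.assoc)
    ultimately show ?thesis by (simp only: *)
  qed
  ultimately have "(q k\<^sub>0 \<longlongrightarrow> 0) at_bot" by simp
  with q show "q k\<^sub>0 = (\<lambda>_. 0)" "c k\<^sub>0 = 0"
    by (blast dest: trig_coeff_tendsto_0_imp_0)+
qed

text \<open>The lowest coefficient vanishes and is removed from the sum; the induction is on the
  number of remaining powers.\<close>

lemma expansion_coeffs_0:
  assumes q: "\<And>k. trig_coeff \<omega> (q k) (c k)"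
    and o: "(\<lambda>t. \<Sum>k=k\<^sub>0..N. q k t * exp (of_int k * t)) \<in> o[at_bot](\<lambda>t. exp (of_int N * t))"
    and k: "k\<^sub>0 \<le> k" "k \<le> N"
  shows "q k = (\<lambda>_. 0) \<and> c k = 0"
  using o k
proof (induction "nat (N - k\<^sub>0)" arbitrary: k\<^sub>0)
  case 0
  then show ?case using expansion_leading_coeff[where q = q and c = c and k\<^sub>0 = k\<^sub>0 and N = N, OF q]
    by (cases "k = k\<^sub>0") auto
next
  case (Suc n)
  note lead = expansion_leading_coeff[where q = q and c = c, OF q Suc.prems(1)]
  have k0: "k\<^sub>0 \<le> N" "q k\<^sub>0 = (\<lambda>_. 0)" "c k\<^sub>0 = 0" using lead Suc by auto
  show ?case
  proof (cases "k = k\<^sub>0")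
    case False
    have "{k\<^sub>0..N} = insert k\<^sub>0 {k\<^sub>0+1..N}" using k0 by auto
    then have "(\<lambda>t. \<Sum>k=k\<^sub>0+1..N. q k t * exp (of_int k * t)) \<in> o[at_bot](\<lambda>t. exp (of_int N * t))"
      using Suc.prems(1) k0 by simp
    then show ?thesis
      by (rule Suc.hyps(1)[rotated]) (use Suc False in auto)
  qed (use k0 in auto)
qed

text \<open>If u is small to order N, so is its truncation at N, and the coefficients of a small
  truncation vanish. Applied to a difference, this compares coefficients of functions that agree
  only up to a finite order.\<close>

lemma has_expansion_small:
  assumes u: "has_expansion \<omega> k\<^sub>0 q c u" and o: "u \<in> o[at_bot](\<lambda>t. exp (of_int N * t))" and k: "k \<le> N"
  shows "q k = (\<lambda>_. 0)" "c k = 0"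
proof -
  have "q k = (\<lambda>_. 0) \<and> c k = 0"
  proof (cases "k < k\<^sub>0")
    case True
    then show ?thesis using u by (auto simp: has_expansion_def)
  next
    case False
    have "(\<lambda>t. u t - (u t - (\<Sum>k=k\<^sub>0..N. q k t * exp (of_int k * t)))) \<in> o[at_bot](\<lambda>t. exp (of_int N * t))"
      by (intro sum_in_smallo o has_expansionD[OF u])
    then show ?thesis
      using False k by (intro expansion_coeffs_0[where \<omega> = \<omega> and q = q and k\<^sub>0 = k\<^sub>0 and N = N] has_expansionD[OF u])
        (simp_all add: has_expansionD[OF u])
  qed
  then show "q k = (\<lambda>_. 0)" "c k = 0" by auto
qed

lemma has_expansion_unique:
  assumes "has_expansion \<omega> k\<^sub>0 q c u" "has_expansion \<omega> k\<^sub>1 q' c' u"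
  shows "c = c'"
  using has_expansion_small(2)[OF has_expansion_diff[OF assms]] by (force simp: fun_eq_iff)

text \<open>Integer multiples \<open>m\<close> of \<open>\<omega>\<close> make the products of two monomials sums of two monomials.\<close>

inductive exp_poly :: "real \<Rightarrow> (real \<Rightarrow> real) \<Rightarrow> bool" for \<omega> where
  monomial: "exp_poly \<omega> (\<lambda>t. t ^ l * (a * cos (of_int m * \<omega> * t) + b * sin (of_int m * \<omega> * t))
               * exp (of_int k * t))"
| add: "exp_poly \<omega> p \<Longrightarrow> exp_poly \<omega> q \<Longrightarrow> exp_poly \<omega> (\<lambda>t. p t + q t)"

lemma exp_poly_scale: "exp_poly \<omega> p \<Longrightarrow> exp_poly \<omega> (\<lambda>t. r * p t)"
proof (induction rule: exp_poly.induct)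
  case (monomial l a m b k)
  show ?case
    using exp_poly.monomial[of \<omega> l "r * a" m "r * b" k] by (simp add: algebra_simps)
next
  case (add p q)
  then show ?case using exp_poly.add by (simp add: distrib_left)
qed

lemma exp_poly_exp: "exp_poly \<omega> (\<lambda>t. r * exp (of_int k * t))"
  using exp_poly.monomial[of \<omega> 0 r 0 0 k] by simp

lemma exp_poly_const: "exp_poly \<omega> (\<lambda>t. r)"
  using exp_poly_exp[of \<omega> r 0] by simp

lemma exp_poly_mult_monomial:
  assumes "exp_poly \<omega> q"
  shows "exp_poly \<omega> (\<lambda>t. t ^ l * (a * cos (of_int m * \<omega> * t) + b * sin (of_int m * \<omega> * t))
               * exp (of_int k * t) * q t)"
  using assms
proof (induction rule: exp_poly.induct)
  case (monomial l' a' m' b' k')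
  \<comment> \<open>The product-to-sum formulas, with C, S and C', S' for the cosine and sine of the
    two angles: the first line carries the frequency m + m', the second m - m'.\<close>
  have product: "((a * a' - b * b') / 2 * (C * C' - S * S') + (a * b' + b * a') / 2 * (S * C' + C * S'))
      + ((a * a' + b * b') / 2 * (C * C' + S * S') + (b * a' - a * b') / 2 * (S * C' - C * S'))
      = (a * C + b * S) * (a' * C' + b' * S')" for C C' S S' :: real
    by (simp add: algebra_simps add_divide_distrib diff_divide_distrib)
  have "exp_poly \<omega> (\<lambda>t. t ^ (l + l') * ((a * a' - b * b') / 2 * cos (of_int (m + m') * \<omega> * t)
               + (a * b' + b * a') / 2 * sin (of_int (m + m') * \<omega> * t)) * exp (of_int (k + k') * t)
       + t ^ (l + l') * ((a * a' + b * b') / 2 * cos (of_int (m - m') * \<omega> * t)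
               + (b * a' - a * b') / 2 * sin (of_int (m - m') * \<omega> * t)) * exp (of_int (k + k') * t))"
    by (intro exp_poly.intros)
  moreover have "t ^ (l + l') * ((a * a' - b * b') / 2 * cos (of_int (m + m') * \<omega> * t)
               + (a * b' + b * a') / 2 * sin (of_int (m + m') * \<omega> * t)) * exp (of_int (k + k') * t)
       + t ^ (l + l') * ((a * a' + b * b') / 2 * cos (of_int (m - m') * \<omega> * t)
               + (b * a' - a * b') / 2 * sin (of_int (m - m') * \<omega> * t)) * exp (of_int (k + k') * t)
     = t ^ l * (a * cos (of_int m * \<omega> * t) + b * sin (of_int m * \<omega> * t)) * exp (of_int k * t) *
       (t ^ l' * (a' * cos (of_int m' * \<omega> * t) + b' * sin (of_int m' * \<omega> * t)) * exp (of_int k' * t))"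
    for t
  proof -
    have eq: "of_int (m + m') * \<omega> * t = of_int m * \<omega> * t + of_int m' * \<omega> * t"
      "of_int (m - m') * \<omega> * t = of_int m * \<omega> * t - of_int m' * \<omega> * t"
      "of_int (k + k') * t = of_int k * t + of_int k' * t"
      by (simp_all add: algebra_simps)
    show ?thesis
      unfolding eq cos_add cos_diff sin_add sin_diff exp_add power_add
      unfolding distrib_right[symmetric] distrib_left[symmetric] product by (simp only: mult_ac)
  qed
  ultimately show ?case by simp
next
  case (add p q)
  then show ?case using exp_poly.add by (simp add: distrib_left)
qed

lemma exp_poly_mult:
  assumes "exp_poly \<omega> p" "exp_poly \<omega> q"
  shows "exp_poly \<omega> (\<lambda>t. p t * q t)"
  using assms
proof (induction rule: exp_poly.induct)
  case (monomial l a m b k)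
  then show ?case by (rule exp_poly_mult_monomial)
next
  case (add p p')
  then show ?case using exp_poly.add by (simp add: distrib_right)
qed

lemma exp_poly_has_expansion:
  assumes "exp_poly \<omega> p"
  shows "\<exists>k\<^sub>0 q c. has_expansion \<omega> k\<^sub>0 q c p"
  using assms
proof (induction rule: exp_poly.induct)
  case (monomial l a m b k)
  \<comment> \<open>\<open>trig_coeff\<close> admits natural multiples of \<omega> only; since sine
    is odd, the sign of m moves into its coefficient.\<close>
  define b' where "b' = (if m < 0 then - b else b)"
  have *: "a * cos (of_int m * \<omega> * t) + b * sin (of_int m * \<omega> * t) =
      a * cos (real (nat \<bar>m\<bar>) * \<omega> * t) + b' * sin (real (nat \<bar>m\<bar>) * \<omega> * t)" for t
    by (cases "m < 0") (simp_all add: b'_def)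
  obtain c where "trig_coeff \<omega> (\<lambda>t. t ^ l *
      (a * cos (real (nat \<bar>m\<bar>) * \<omega> * t) + b' * sin (real (nat \<bar>m\<bar>) * \<omega> * t))) c"
    using trig_coeff_monomial by blast
  from has_expansion_single[OF this, of k] show ?case unfolding * by blast
next
  case (add p q)
  then show ?case by (blast intro: has_expansion_add)
qed

lemma exp_poly_bigo:
  assumes "exp_poly \<omega> p"
  shows "\<exists>K :: int. p \<in> O[at_bot](\<lambda>t. exp (of_int K * t))"
proof -
  from exp_poly_has_expansion[OF assms] obtain k\<^sub>0 q c where "has_expansion \<omega> k\<^sub>0 q c p" by blast
  \<comment> \<open>Truncation one step below the start leaves an empty sum, so the remainder is p
    itself.\<close>
  then have "(\<lambda>t. p t - (\<Sum>k=k\<^sub>0..k\<^sub>0 - 1. q k t * exp (of_int k * t))) \<in> o[at_bot](\<lambda>t. exp (of_int (k\<^sub>0 - 1) * t))"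
    unfolding has_expansion_def by blast
  then show ?thesis by (intro exI[of _ "k\<^sub>0 - 1"] landau_o.small_imp_big) simp
qed

text \<open>If both the exponential rate and the frequency vanish, the monomial is a power of t and
  integration raises its degree. Otherwise integration by parts lowers the degree l, which is the
  induction.\<close>

lemma exp_poly_antiderivative_aux:
  "\<exists>P. exp_poly \<omega> P \<and> (\<forall>t. (P has_real_derivative
      t ^ l * (a * cos (of_int m * \<omega> * t) + b * sin (of_int m * \<omega> * t)) * exp (of_int k * t)) (at t))"
proof (cases "k = 0 \<and> of_int m * \<omega> = 0")
  case True
  have "exp_poly \<omega> (\<lambda>t. t ^ Suc l * (a / real (Suc l) * cos (of_int 0 * \<omega> * t) + 0 * sin (of_int 0 * \<omega> * t)) * exp (of_int 0 * t))"
    by (rule exp_poly.intros)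
  then have "exp_poly \<omega> (\<lambda>t. a * t ^ Suc l / real (Suc l))"
    by (simp add: mult.commute)
  moreover have "((\<lambda>t. a * t ^ Suc l / real (Suc l)) has_real_derivative a * (real (Suc l) * t ^ l) / real (Suc l)) (at t)" for t
    by (intro DERIV_cdivide DERIV_cmult) (use DERIV_pow[of "Suc l" t] in simp)
  then have "((\<lambda>t. a * t ^ Suc l / real (Suc l)) has_real_derivative a * t ^ l) (at t)" for t
    by simp
  moreover have "t ^ l * (a * cos (of_int m * \<omega> * t) + b * sin (of_int m * \<omega> * t)) * exp (of_int k * t)
      = a * t ^ l" for t
    using True by (elim conjE) (simp only: mult_zero_left, simp)
  ultimately show ?thesis
    by (simp only:) blast
next
  case False
  define \<mu> where "\<mu> = of_int m * \<omega>"
  \<comment> \<open>Comparing the cosine and sine parts of the derivative of \<open>(\<alpha> * cos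
    (\<mu> * t) + \<beta> * sin (\<mu> * t)) * exp (of_int k * t)\<close> with a and b gives this
    linear system. Its determinant D is nonzero precisely outside the first case.\<close>
  have solve: "\<exists>\<alpha> \<beta>. \<alpha> * of_int k + \<beta> * \<mu> = a \<and> \<beta> * of_int k - \<alpha> * \<mu> = b" for a b :: real
  proof -
    define D where "D = real_of_int k * real_of_int k + \<mu> * \<mu>"
    have D: "D \<noteq> 0" using False by (auto simp: D_def \<mu>_def)
    define \<alpha> where "\<alpha> = (a * of_int k - b * \<mu>) / D"
    define \<beta> where "\<beta> = (a * \<mu> + b * of_int k) / D"
    have "\<alpha> * D = a * of_int k - b * \<mu>" "\<beta> * D = a * \<mu> + b * of_int k"
      using D by (simp_all add: \<alpha>_def \<beta>_def)
    then have "(\<alpha> * of_int k + \<beta> * \<mu>) * D = a * D" "(\<beta> * of_int k - \<alpha> * \<mu>) * D = b * D"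
      unfolding D_def by algebra+
    then show ?thesis using D by auto
  qed
  show ?thesis
  proof (induction l arbitrary: a b)
    case (0 a b)
    obtain \<alpha> \<beta> where eq: "\<alpha> * of_int k + \<beta> * \<mu> = a" "\<beta> * of_int k - \<alpha> * \<mu> = b"
      using solve by blast
    have "((\<lambda>t. (\<alpha> * cos (\<mu> * t) + \<beta> * sin (\<mu> * t)) * exp (of_int k * t)) has_real_derivative
       (a * cos (\<mu> * t) + b * sin (\<mu> * t)) * exp (of_int k * t)) (at t)" for t
      by (rule DERIV_cong, (rule derivative_eq_intros refl)+)
        (simp add: eq(1)[symmetric] eq(2)[symmetric] algebra_simps)
    moreover have "exp_poly \<omega> (\<lambda>t. (\<alpha> * cos (\<mu> * t) + \<beta> * sin (\<mu> * t)) * exp (of_int k * t))"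
      using exp_poly.monomial[of \<omega> 0 \<alpha> m \<beta> k] by (simp add: \<mu>_def)
    ultimately show ?case by (auto simp: \<mu>_def)
  next
    case (Suc l a b)
    obtain \<alpha> \<beta> where eq: "\<alpha> * of_int k + \<beta> * \<mu> = a" "\<beta> * of_int k - \<alpha> * \<mu> = b"
      using solve by blast
    obtain P where P: "exp_poly \<omega> P" "\<And>t. (P has_real_derivative
      t ^ l * (\<alpha> * cos (\<mu> * t) + \<beta> * sin (\<mu> * t)) * exp (of_int k * t)) (at t)"
      using Suc[of \<alpha> \<beta>] by (auto simp: \<mu>_def)
    have "((\<lambda>t. t ^ Suc l * (\<alpha> * cos (\<mu> * t) + \<beta> * sin (\<mu> * t)) * exp (of_int k * t) + (- real (Suc l)) * P t)
        has_real_derivative t ^ Suc l * (a * cos (\<mu> * t) + b * sin (\<mu> * t)) * exp (of_int k * t)) (at t)" for t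
      by (rule DERIV_cong, (rule derivative_eq_intros P(2) refl)+)
        (simp add: eq(1)[symmetric] eq(2)[symmetric] algebra_simps)
    moreover have "exp_poly \<omega> (\<lambda>t. t ^ Suc l * (\<alpha> * cos (\<mu> * t) + \<beta> * sin (\<mu> * t)) * exp (of_int k * t) + (- real (Suc l)) * P t)"
      unfolding \<mu>_def by (intro exp_poly.intros exp_poly_scale P(1))
    ultimately show ?case by (auto simp: \<mu>_def)
  qed
qed

lemma exp_poly_antiderivative:
  assumes "exp_poly \<omega> p"
  shows "\<exists>P. exp_poly \<omega> P \<and> (\<forall>t. (P has_real_derivative p t) (at t))"
  using assms
proof (induction rule: exp_poly.induct)
  case (monomial l a m b k)
  show ?case by (rule exp_poly_antiderivative_aux)
next
  case (add p q)
  then obtain P Q where "exp_poly \<omega> P \<and> (\<forall>t. (P has_real_derivative p t) (at t))"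
    "exp_poly \<omega> Q \<and> (\<forall>t. (Q has_real_derivative q t) (at t))" by blast
  then show ?case by (intro exI[of _ "\<lambda>t. P t + Q t"]) (auto intro: exp_poly.add DERIV_add)
qed


section \<open>Functions approximable to every order by exponential polynomials\<close>

definition expandable :: "real \<Rightarrow> (real \<Rightarrow> real) \<Rightarrow> bool" where
  "expandable \<omega> u \<longleftrightarrow>
     (\<forall>N :: int. \<exists>p. exp_poly \<omega> p \<and> (\<lambda>t. u t - p t) \<in> o[at_bot](\<lambda>t. exp (of_int N * t)))"

lemma exp_poly_imp_expandable: "exp_poly \<omega> p \<Longrightarrow> expandable \<omega> p"
  unfolding expandable_def by (auto intro!: exI[of _ p])

lemma expandable_add:
  assumes "expandable \<omega> u" "expandable \<omega> v"
  shows "expandable \<omega> (\<lambda>t. u t + v t)"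
  unfolding expandable_def
proof
  fix N :: int
  obtain p q where p: "exp_poly \<omega> p" "(\<lambda>t. u t - p t) \<in> o[at_bot](\<lambda>t. exp (of_int N * t))"
    and q: "exp_poly \<omega> q" "(\<lambda>t. v t - q t) \<in> o[at_bot](\<lambda>t. exp (of_int N * t))"
    using assms unfolding expandable_def by metis
  have "(\<lambda>t. u t + v t - (p t + q t)) \<in> o[at_bot](\<lambda>t. exp (of_int N * t))"
    using sum_in_smallo(1)[OF p(2) q(2)] by (simp add: algebra_simps)
  then show "\<exists>p. exp_poly \<omega> p \<and> (\<lambda>t. u t + v t - p t) \<in> o[at_bot](\<lambda>t. exp (of_int N * t))"
    using exp_poly.add[OF p(1) q(1)] by blast
qed

lemma expandable_bigo:
  assumes "expandable \<omega> u"
  shows "\<exists>K :: int. u \<in> O[at_bot](\<lambda>t. exp (of_int K * t))"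
proof -
  obtain p where p: "exp_poly \<omega> p" "(\<lambda>t. u t - p t) \<in> o[at_bot](\<lambda>t. exp (of_int 0 * t))"
    using assms unfolding expandable_def by metis
  obtain K :: int where K: "p \<in> O[at_bot](\<lambda>t. exp (of_int K * t))"
    using exp_poly_bigo[OF p(1)] by blast
  have "(\<lambda>t. (u t - p t) + p t) \<in> O[at_bot](\<lambda>t. exp (of_int (min K 0) * t))"
  proof (rule sum_in_bigo)
    show "(\<lambda>t. u t - p t) \<in> O[at_bot](\<lambda>t. exp (of_int (min K 0) * t))"
      by (rule landau_o.big.trans[OF landau_o.small_imp_big[OF p(2)]], rule exp_bigo_at_bot) simp
    show "p \<in> O[at_bot](\<lambda>t. exp (of_int (min K 0) * t))"
      by (rule landau_o.big.trans[OF K], rule exp_bigo_at_bot) simp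
  qed
  then show ?thesis by auto
qed

text \<open>The error splits as \<open>(u - p) * v + p * (v - q)\<close>. The factors may grow, so p
  is taken more accurate by the growth K of v, and only then q by the growth L of the chosen
  p.\<close>

lemma expandable_mult:
  assumes "expandable \<omega> u" "expandable \<omega> v"
  shows "expandable \<omega> (\<lambda>t. u t * v t)"
  unfolding expandable_def
proof
  fix N :: int
  obtain K :: int where K: "v \<in> O[at_bot](\<lambda>t. exp (of_int K * t))"
    using expandable_bigo[OF assms(2)] by blast
  obtain p where p: "exp_poly \<omega> p" "(\<lambda>t. u t - p t) \<in> o[at_bot](\<lambda>t. exp (of_int (N - K) * t))"
    using assms(1) unfolding expandable_def by metis
  obtain L :: int where L: "p \<in> O[at_bot](\<lambda>t. exp (of_int L * t))"
    using exp_poly_bigo[OF p(1)] by blast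
  obtain q where q: "exp_poly \<omega> q" "(\<lambda>t. v t - q t) \<in> o[at_bot](\<lambda>t. exp (of_int (N - L) * t))"
    using assms(2) unfolding expandable_def by metis
  have "(\<lambda>t. (u t - p t) * v t + p t * (v t - q t)) \<in> o[at_bot](\<lambda>t. exp (of_int N * t))"
  proof (rule sum_in_smallo)
    have "exp (of_int (N - K) * t) * exp (of_int K * t) = exp (of_int N * t)" for t :: real
      by (simp add: exp_add[symmetric] left_diff_distrib)
    with landau_o.small_big_mult[OF p(2) K]
    show "(\<lambda>t. (u t - p t) * v t) \<in> o[at_bot](\<lambda>t. exp (of_int N * t))" by (simp only:)
    have "exp (of_int L * t) * exp (of_int (N - L) * t) = exp (of_int N * t)" for t :: real
      by (simp add: exp_add[symmetric] left_diff_distrib)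
    with landau_o.big_small_mult[OF L q(2)]
    show "(\<lambda>t. p t * (v t - q t)) \<in> o[at_bot](\<lambda>t. exp (of_int N * t))" by (simp only:)
  qed
  then have "(\<lambda>t. u t * v t - p t * q t) \<in> o[at_bot](\<lambda>t. exp (of_int N * t))"
    by (simp add: algebra_simps)
  then show "\<exists>p. exp_poly \<omega> p \<and> (\<lambda>t. u t * v t - p t) \<in> o[at_bot](\<lambda>t. exp (of_int N * t))"
    using exp_poly_mult[OF p(1) q(1)] by blast
qed

lemma expandable_const: "expandable \<omega> (\<lambda>t. r)"
  by (intro exp_poly_imp_expandable exp_poly_const)

lemma expandable_scale: "expandable \<omega> u \<Longrightarrow> expandable \<omega> (\<lambda>t. r * u t)"
  by (intro expandable_mult expandable_const)

lemma expandable_diff: "expandable \<omega> u \<Longrightarrow> expandable \<omega> v \<Longrightarrow> expandable \<omega> (\<lambda>t. u t - v t)"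
  using expandable_add[OF _ expandable_scale[of \<omega> v "- 1"]] by simp

lemma expandable_sum: "(\<And>i. i \<in> I \<Longrightarrow> expandable \<omega> (u i)) \<Longrightarrow> expandable \<omega> (\<lambda>t. \<Sum>i\<in>I. u i t)"
  by (induction I rule: infinite_finite_induct) (auto intro: expandable_add expandable_const)

text \<open>Because r is positive, the remainder R is integrable at -\<infinity>. Hence G has a
  limit C there, and G - C is the integral of R from -\<infinity>, which inherits the order of
  R.\<close>

lemma antiderivative_smallo:
  assumes G: "\<And>t. (G has_real_derivative R t) (at t)"
    and R: "R \<in> o[at_bot](\<lambda>t. exp (r * t))" and r: "r > 0"
  shows "\<exists>C. (\<lambda>t. G t - C) \<in> o[at_bot](\<lambda>t. exp (r * t))"
proof -
  \<comment> \<open>Near -\<infinity>, R is dominated by the derivative of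
    \<open>c * exp (r * t)\<close>; adding G to this function or subtracting it therefore gives
    nondecreasing functions.\<close>
  have bound: "\<exists>T. \<forall>t\<le>T. \<forall>t'\<le>t. \<bar>G t - G t'\<bar> \<le> c * exp (r * t)" if "c > 0" for c
  proof -
    have "\<forall>\<^sub>F t in at_bot. norm (R t) \<le> (c * r) * norm (exp (r * t))"
      by (rule landau_o.smallD[OF R]) (use that r in simp)
    then obtain T where T: "\<And>t. t \<le> T \<Longrightarrow> \<bar>R t\<bar> \<le> c * r * exp (r * t)"
      by (auto simp: eventually_at_bot_linorder)
    have "\<bar>G t - G t'\<bar> \<le> c * exp (r * t)" if t: "t \<le> T" "t' \<le> t" for t t'
    proof -
      have D: "((\<lambda>t. c * exp (r * t)) has_real_derivative c * r * exp (r * x)) (at x)" for x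
        by (auto intro!: derivative_eq_intros)
      have nonneg: "c * r * exp (r * x) - R x \<ge> 0" "c * r * exp (r * x) + R x \<ge> 0" if "x \<le> t" for x
        using T[of x] that t by (simp_all add: abs_le_iff)
      have "c * exp (r * t') - G t' \<le> c * exp (r * t) - G t"
        by (rule DERIV_nonneg_imp_nondecreasing[OF t(2)])
          (use nonneg(1) DERIV_diff[OF D G] in blast)
      moreover have "c * exp (r * t') + G t' \<le> c * exp (r * t) + G t"
        by (rule DERIV_nonneg_imp_nondecreasing[OF t(2)])
          (use nonneg(2) DERIV_add[OF D G] in blast)
      moreover have "c * exp (r * t') \<ge> 0" using that \<open>c > 0\<close> by simp
      ultimately show ?thesis by linarith
    qed
    then show ?thesis by blast
  qed
  have lim: "filterlim (\<lambda>n. - real n) at_bot sequentially" by real_asymp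
  have "Cauchy (\<lambda>n. G (- real n))"
  proof (rule metric_CauchyI)
    fix e :: real assume e: "e > 0"
    obtain T where T: "\<And>t t'. t \<le> T \<Longrightarrow> t' \<le> t \<Longrightarrow> \<bar>G t - G t'\<bar> \<le> 1 * exp (r * t)"
      using bound[of 1] by auto
    have "((\<lambda>t. t ^ 0 * exp (r * t)) \<longlongrightarrow> 0) at_bot" by (rule power_times_exp_at_bot[OF r])
    then have "\<forall>\<^sub>F t in at_bot. exp (r * t) < e"
      using e by (intro order_tendstoD(2)[of _ 0]) simp_all
    then obtain T' where T': "\<And>t. t \<le> T' \<Longrightarrow> exp (r * t) < e"
      by (auto simp: eventually_at_bot_linorder)
    obtain M :: nat where M: "- real M \<le> min T T'"
      using reals_Archimedean2[of "- min T T'"] by (metis less_eq_real_def minus_le_iff)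
    have close: "dist (G (- real m)) (G (- real n)) < e" if "M \<le> m" "m \<le> n" for m n
    proof -
      have "- real m \<le> T" "- real m \<le> T'" "- real n \<le> - real m" using that M by auto
      then show ?thesis using T[of "- real m" "- real n"] T'[of "- real m"]
        by (simp add: dist_real_def)
    qed
    have "dist (G (- real m)) (G (- real n)) < e" if "M \<le> m" "M \<le> n" for m n
      using close[of m n] close[of n m] that by (cases "m \<le> n") (auto simp: dist_commute)
    then show "\<exists>M. \<forall>m\<ge>M. \<forall>n\<ge>M. dist (G (- real m)) (G (- real n)) < e" by blast
  qed
  then obtain C where C: "(\<lambda>n. G (- real n)) \<longlonglongrightarrow> C"
    using Cauchy_convergent convergent_def by blast
  \<comment> \<open>The bound on \<open>G t - G t'\<close> is uniform in t', so t' may run to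
    -\<infinity> along the negative integers.\<close>
  have "(\<lambda>t. G t - C) \<in> o[at_bot](\<lambda>t. exp (r * t))"
  proof (rule landau_o.smallI)
    fix c :: real assume "c > 0"
    then obtain T where T: "\<And>t t'. t \<le> T \<Longrightarrow> t' \<le> t \<Longrightarrow> \<bar>G t - G t'\<bar> \<le> c * exp (r * t)"
      using bound[of c] by auto
    have "\<bar>G t - C\<bar> \<le> c * exp (r * t)" if "t \<le> T" for t
    proof (rule tendsto_upperbound)
      show "(\<lambda>n. \<bar>G t - G (- real n)\<bar>) \<longlonglongrightarrow> \<bar>G t - C\<bar>"
        by (intro tendsto_intros C)
      have "\<forall>\<^sub>F n in sequentially. - real n \<le> t"
        using lim by (simp add: filterlim_at_bot)
      then show "\<forall>\<^sub>F n in sequentially. \<bar>G t - G (- real n)\<bar> \<le> c * exp (r * t)"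
        by eventually_elim (use T that in blast)
    qed simp
    then show "\<forall>\<^sub>F t in at_bot. norm (G t - C) \<le> c * norm (exp (r * t))"
      by (auto simp: eventually_at_bot_linorder)
  qed
  then show ?thesis by blast
qed

lemma expandable_antiderivative:
  assumes "expandable \<omega> f" and F: "\<And>t. (F has_real_derivative f t) (at t)"
  shows "expandable \<omega> F"
  unfolding expandable_def
proof
  fix N :: int
  \<comment> \<open>A positive order makes the remainder integrable; the constant C that arises is
    itself an exponential polynomial.\<close>
  define M where "M = max N 1"
  obtain p where p: "exp_poly \<omega> p" "(\<lambda>t. f t - p t) \<in> o[at_bot](\<lambda>t. exp (of_int M * t))"
    using assms unfolding expandable_def by metis
  obtain P where P: "exp_poly \<omega> P" "\<And>t. (P has_real_derivative p t) (at t)"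
    using exp_poly_antiderivative[OF p(1)] by blast
  obtain C where C: "(\<lambda>t. F t - P t - C) \<in> o[at_bot](\<lambda>t. exp (of_int M * t))"
    using antiderivative_smallo[OF DERIV_diff[OF F P(2)] p(2)] by (auto simp: M_def less_max_iff_disj)
  have "(\<lambda>t. F t - (P t + C)) \<in> o[at_bot](\<lambda>t. exp (of_int M * t))"
    using C by (simp add: algebra_simps)
  then have "(\<lambda>t. F t - (P t + C)) \<in> o[at_bot](\<lambda>t. exp (of_int N * t))"
    by (rule landau_o.small_big_trans, intro exp_bigo_at_bot) (simp add: M_def)
  then show "\<exists>p. exp_poly \<omega> p \<and> (\<lambda>t. F t - p t) \<in> o[at_bot](\<lambda>t. exp (of_int N * t))"
    using exp_poly.add[OF P(1) exp_poly_const[of \<omega> C]] by blast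
qed

text \<open>The approximants of different orders are chosen independently, but any two of them agree
  to the smaller order. By uniqueness their coefficients agree up to there, so one coefficient
  family fits all of them.\<close>

lemma expandable_has_expansion:
  assumes "expandable \<omega> u"
  shows "\<exists>k\<^sub>0 q c. has_expansion \<omega> k\<^sub>0 q c u"
proof -
  obtain p where p: "\<And>N. exp_poly \<omega> (p N)"
    "\<And>N. (\<lambda>t. u t - p N t) \<in> o[at_bot](\<lambda>t. exp (of_int N * t))"
    using assms unfolding expandable_def by metis
  obtain k q c where e: "\<And>N. has_expansion \<omega> (k N) (q N) (c N) (p N)"
    using exp_poly_has_expansion[OF p(1)] by metis
  have smaller: "(\<lambda>t. u t - p N t) \<in> o[at_bot](\<lambda>t. exp (of_int j * t))" if "j \<le> N" for j N
    by (rule landau_o.small_big_trans[OF p(2)], intro exp_bigo_at_bot) (use that in simp)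
  have agree: "q N j = q M j \<and> c N j = c M j" if "j \<le> N" "j \<le> M" for N M j
  proof -
    have "(\<lambda>t. p N t - p M t) \<in> o[at_bot](\<lambda>t. exp (of_int j * t))"
      using sum_in_smallo(2)[OF smaller[OF that(2)] smaller[OF that(1)]] by simp
    from has_expansion_small[OF has_expansion_diff[OF e[of N] e[of M]] this order_refl]
    show ?thesis by (auto simp: fun_eq_iff)
  qed
  \<comment> \<open>The j-th coefficient is read from an approximant of order at least j. Taking
    \<open>max j 0\<close> lets the single approximant \<open>p 0\<close> supply all negative j,
    which gives the common lower bound K.\<close>
  define q' where "q' j = q (max j 0) j" for j
  define c' where "c' j = c (max j 0) j" for j
  define K where "K = min (k 0) 0"
  have q': "q M j = q' j" if "j \<le> M" "0 \<le> M" for M j :: int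
    using agree[of j M "max j 0"] that by (simp add: q'_def)
  have low: "q' j = (\<lambda>_. 0)" "c' j = 0" if "j < K" for j
    using that has_expansionD(2,3)[OF e[of 0], of j] by (simp_all add: K_def q'_def c'_def)
  have "has_expansion \<omega> K q' c' u"
    unfolding has_expansion_def
  proof (intro conjI allI impI)
    show "trig_coeff \<omega> (q' j) (c' j)" for j
      unfolding q'_def c'_def by (rule has_expansionD[OF e])
    fix N :: int
    define M where "M = max N 0"
    have "has_expansion \<omega> (min (k M) K) (q M) (c M) (p M)"
      by (rule has_expansion_lower[OF e]) simp
    then have "(\<lambda>t. (u t - p M t) + (p M t - (\<Sum>j=min (k M) K..N. q M j t * exp (of_int j * t))))
        \<in> o[at_bot](\<lambda>t. exp (of_int N * t))"
      by (intro sum_in_smallo smaller has_expansionD(4)) (simp_all add: M_def)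
    moreover have "(\<Sum>j=min (k M) K..N. q M j t * exp (of_int j * t)) =
        (\<Sum>j=K..N. q' j t * exp (of_int j * t))" for t
      by (rule sum.mono_neutral_cong_right) (auto simp: q' M_def low)
    ultimately show "(\<lambda>t. u t - (\<Sum>j=K..N. q' j t * exp (of_int j * t))) \<in> o[at_bot](\<lambda>t. exp (of_int N * t))"
      by simp
  qed (use low in auto)
  then show ?thesis by blast
qed

lemma has_expansion_cong:
  assumes "has_expansion \<omega> k\<^sub>0 q c u" "\<forall>\<^sub>F t in at_bot. u t = v t"
  shows "has_expansion \<omega> k\<^sub>0 q c v"
proof -
  have "(\<lambda>t. v t - (\<Sum>k=k\<^sub>0..N. q k t * exp (of_int k * t))) \<in> o[at_bot](\<lambda>t. exp (of_int N * t))" for N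
    by (rule landau_o.small.in_cong[THEN iffD1, OF _ has_expansionD(4)[OF assms(1)]])
      (use assms(2) in \<open>auto elim: eventually_mono\<close>)
  then show ?thesis using assms(1) unfolding has_expansion_def by blast
qed

lemma expansion_without_exp2_iff:
  "expansion_without_exp2 \<omega> W \<longleftrightarrow> (\<exists>k\<^sub>0 q c. has_expansion \<omega> k\<^sub>0 q c W \<and> c 2 = 0 \<and> c (- 2) = 0)"
proof
  assume "expansion_without_exp2 \<omega> W"
  then obtain k\<^sub>0 q c where e: "\<And>k. trig_coeff \<omega> (q k) (c k)" "c 2 = 0" "c (- 2) = 0"
    "\<And>N. (\<lambda>t. W t - (\<Sum>k=k\<^sub>0..N. q k t * exp (of_int k * t))) \<in> o[at_bot](\<lambda>t. exp (of_int N * t))"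
    unfolding expansion_without_exp2_def by blast
  \<comment> \<open>The coefficients below \<open>k\<^sub>0\<close> never enter the sums, so setting
    them to 0 changes no remainder.\<close>
  have "has_expansion \<omega> k\<^sub>0 (\<lambda>k. if k < k\<^sub>0 then (\<lambda>_. 0) else q k) (\<lambda>k. if k < k\<^sub>0 then 0 else c k) W"
  proof -
    have "(\<Sum>k=k\<^sub>0..N. (if k < k\<^sub>0 then (\<lambda>_. 0) else q k) t * exp (of_int k * t)) =
        (\<Sum>k=k\<^sub>0..N. q k t * exp (of_int k * t))" for N t
      by (rule sum.cong) auto
    then show ?thesis
      using e trig_coeff_const[of \<omega> 0] by (simp add: has_expansion_def)
  qed
  then show "\<exists>k\<^sub>0 q c. has_expansion \<omega> k\<^sub>0 q c W \<and> c 2 = 0 \<and> c (- 2) = 0"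
    using e(2,3) by (intro exI conjI) (assumption | simp)+
qed (unfold has_expansion_def expansion_without_exp2_def, blast)

lemma has_expansion_exp:
  "has_expansion \<omega> j (\<lambda>k. if k = j then (\<lambda>_. r) else (\<lambda>_. 0)) (\<lambda>k. if k = j then r else 0)
     (\<lambda>t. r * exp (of_int j * t))"
  by (rule has_expansion_single[OF trig_coeff_const])

text \<open>For n \<ge> 1 the terms with A and B are themselves \<open>O(exp (- 2 * n * t))\<close>,
  so W satisfies the bound exactly if u does. This removes W: A and B become the constant
  coefficients of u at the powers 2 and -2.\<close>

lemma left_form_iff:
  assumes n: "n \<ge> 1"
  shows "left_form \<omega> n A B u \<longleftrightarrow> u \<in> O[at_bot](\<lambda>t. exp (- 2 * real n * t)) \<and>
           (\<exists>k\<^sub>0 q c. has_expansion \<omega> k\<^sub>0 q c u \<and> c 2 = A \<and> c (- 2) = B)"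
    (is "_ \<longleftrightarrow> ?R")
proof
  have O: "(\<lambda>t. A * exp (2 * t) + B * exp (- 2 * t)) \<in> O[at_bot](\<lambda>t. exp (- 2 * real n * t))"
  proof (rule sum_in_bigo)
    have "(\<lambda>t :: real. exp (2 * t)) \<in> O[at_bot](\<lambda>t. exp (- 2 * real n * t))"
      by (rule exp_bigo_at_bot) simp
    then show "(\<lambda>t. A * exp (2 * t)) \<in> O[at_bot](\<lambda>t. exp (- 2 * real n * t))"
      by (cases "A = 0") simp_all
    have "(\<lambda>t :: real. exp (- 2 * t)) \<in> O[at_bot](\<lambda>t. exp (- 2 * real n * t))"
      by (rule exp_bigo_at_bot) (use n in simp)
    then show "(\<lambda>t. B * exp (- 2 * t)) \<in> O[at_bot](\<lambda>t. exp (- 2 * real n * t))"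
      by (cases "B = 0") simp_all
  qed
  {
    assume "left_form \<omega> n A B u"
    then obtain W where W: "\<forall>\<^sub>F t in at_bot. u t = A * exp (2 * t) + B * exp (- 2 * t) + W t"
      "W \<in> O[at_bot](\<lambda>t. exp (- 2 * real n * t))" "expansion_without_exp2 \<omega> W"
      unfolding left_form_def by blast
    obtain k\<^sub>0 q c where e: "has_expansion \<omega> k\<^sub>0 q c W" "c 2 = 0" "c (- 2) = 0"
      using W(3) unfolding expansion_without_exp2_iff by blast
    note e' = has_expansion_add[OF has_expansion_add[OF has_expansion_exp[of \<omega> 2 A] has_expansion_exp[of \<omega> "- 2" B]] e(1)]
    have "\<forall>\<^sub>F t in at_bot. A * exp (of_int 2 * t) + B * exp (of_int (- 2) * t) + W t = u t"
      using W(1) by (auto elim: eventually_mono)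
    note u = has_expansion_cong[OF e' this]
    have "u \<in> O[at_bot](\<lambda>t. exp (- 2 * real n * t))"
      using landau_o.big.in_cong[OF W(1)] sum_in_bigo(1)[OF O W(2)] by blast
    then show ?R
      using u by (intro conjI exI) (assumption | simp add: e(2,3))+
  next
    assume ?R
    then obtain k\<^sub>0 q c where u: "u \<in> O[at_bot](\<lambda>t. exp (- 2 * real n * t))"
      and e: "has_expansion \<omega> k\<^sub>0 q c u" "c 2 = A" "c (- 2) = B" by blast
    define W where "W t = u t - (A * exp (2 * t) + B * exp (- 2 * t))" for t
    note e' = has_expansion_diff[OF e(1) has_expansion_add[OF has_expansion_exp[of \<omega> 2 A] has_expansion_exp[of \<omega> "- 2" B]]]
    have "\<forall>\<^sub>F t in at_bot. u t - (A * exp (of_int 2 * t) + B * exp (of_int (- 2) * t)) = W t"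
      by (simp add: W_def)
    note has_expansion_cong[OF e' this]
    then have "expansion_without_exp2 \<omega> W"
      unfolding expansion_without_exp2_iff
      by (intro exI conjI) (assumption | simp add: e(2,3))+
    moreover have "W \<in> O[at_bot](\<lambda>t. exp (- 2 * real n * t))"
      unfolding W_def by (rule sum_in_bigo(2)[OF u O])
    ultimately show "left_form \<omega> n A B u"
      unfolding left_form_def by (intro exI[of _ W] conjI) (auto simp: W_def)
  }
qed

section \<open>The linearised equation\<close>

text \<open>Expansions see only t near -\<infinity>, whereas the range of validity extends to both
  sides; a bound for all t serves both ends.\<close>

definition growth :: "real \<Rightarrow> (real \<Rightarrow> real) \<Rightarrow> bool" where
  "growth r f \<longleftrightarrow> (\<exists>C. \<forall>t. \<bar>f t\<bar> \<le> C * exp (r * \<bar>t\<bar>))"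

lemma growthE:
  assumes "growth r f"
  obtains C where "C \<ge> 0" "\<And>t. \<bar>f t\<bar> \<le> C * exp (r * \<bar>t\<bar>)"
proof -
  obtain C where C: "\<And>t. \<bar>f t\<bar> \<le> C * exp (r * \<bar>t\<bar>)"
    using assms unfolding growth_def by blast
  have "0 \<le> C" using order_trans[OF abs_ge_zero C[of 0]] by simp
  with C show ?thesis using that by blast
qed

lemma growth_mono:
  assumes "growth r f" "r \<le> r'"
  shows "growth r' f"
proof -
  obtain C where C: "C \<ge> 0" "\<And>t. \<bar>f t\<bar> \<le> C * exp (r * \<bar>t\<bar>)" using growthE[OF assms(1)] by blast
  have "C * exp (r * \<bar>t\<bar>) \<le> C * exp (r' * \<bar>t\<bar>)" for t
    using C(1) assms(2) by (intro mult_left_mono) (auto intro: mult_right_mono)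
  with C(2) show ?thesis unfolding growth_def by (meson order_trans)
qed

lemma growth_add:
  assumes "growth r f" "growth r g"
  shows "growth r (\<lambda>t. f t + g t)"
proof -
  obtain C where C: "\<And>t. \<bar>f t\<bar> \<le> C * exp (r * \<bar>t\<bar>)" using growthE[OF assms(1)] by blast
  obtain D where D: "\<And>t. \<bar>g t\<bar> \<le> D * exp (r * \<bar>t\<bar>)" using growthE[OF assms(2)] by blast
  have "\<bar>f t + g t\<bar> \<le> (C + D) * exp (r * \<bar>t\<bar>)" for t
    using abs_triangle_ineq[of "f t" "g t"] C[of t] D[of t] by (simp add: distrib_right)
  then show ?thesis unfolding growth_def by blast
qed

lemma growth_mult:
  assumes "growth r f" "growth r' g"
  shows "growth (r + r') (\<lambda>t. f t * g t)"
proof -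
  obtain C where C: "C \<ge> 0" "\<And>t. \<bar>f t\<bar> \<le> C * exp (r * \<bar>t\<bar>)" using growthE[OF assms(1)] by blast
  obtain D where D: "\<And>t. \<bar>g t\<bar> \<le> D * exp (r' * \<bar>t\<bar>)" using growthE[OF assms(2)] by blast
  have "\<bar>f t * g t\<bar> \<le> (C * exp (r * \<bar>t\<bar>)) * (D * exp (r' * \<bar>t\<bar>))" for t
    unfolding abs_mult by (intro mult_mono C D) (use C in auto)
  then have "\<bar>f t * g t\<bar> \<le> C * D * exp ((r + r') * \<bar>t\<bar>)" for t
    unfolding distrib_right exp_add by (simp add: mult_ac)
  then show ?thesis unfolding growth_def by blast
qed

lemma growth_const: "growth 0 (\<lambda>t. c)"
  unfolding growth_def by (intro exI[of _ "\<bar>c\<bar>"]) simp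

lemma growth_scale: "growth r f \<Longrightarrow> growth r (\<lambda>t. c * f t)"
  using growth_mult[OF growth_const[of c]] by simp

lemma growth_0: "growth r (\<lambda>t. 0)"
  unfolding growth_def by (intro exI[of _ 0]) simp

lemma growth_sum: "(\<And>i. i \<in> I \<Longrightarrow> growth r (f i)) \<Longrightarrow> growth r (\<lambda>t. \<Sum>i\<in>I. f i t)"
  by (induction I rule: infinite_finite_induct) (auto intro: growth_add growth_0)

text \<open>F is compared with \<open>C / r * exp (r * x)\<close>, which bounds its increments. For
  r < 0 that function is bounded and only the constant \<open>F 0\<close> persists, hence the rate
  \<open>max r 0\<close>; r = 0 would bring in a linear factor.\<close>

lemma growth_antiderivative_aux:
  assumes F: "\<And>x. (F has_real_derivative f x) (at x)"
    and f: "\<And>x. x \<ge> 0 \<Longrightarrow> \<bar>f x\<bar> \<le> C * exp (r * x)" and r: "r \<noteq> 0" and t: "t \<ge> 0"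
  shows "\<bar>F t\<bar> \<le> (\<bar>F 0\<bar> + C / \<bar>r\<bar>) * exp (max r 0 * t)"
proof -
  have C: "C \<ge> 0" using order_trans[OF abs_ge_zero f[of 0]] by simp
  have D: "((\<lambda>x. C / r * exp (r * x)) has_real_derivative C * exp (r * x)) (at x)" for x
    using r by (auto intro!: derivative_eq_intros)
  have "C * exp (r * x) - f x \<ge> 0" "C * exp (r * x) + f x \<ge> 0" if "x \<ge> 0" for x
    using f[OF that] by (simp_all add: abs_le_iff)
  note nonneg = this
  have "C / r * exp (r * 0) - F 0 \<le> C / r * exp (r * t) - F t"
    by (rule DERIV_nonneg_imp_nondecreasing[OF t]) (use nonneg(1) DERIV_diff[OF D F] in blast)
  moreover have "C / r * exp (r * 0) + F 0 \<le> C / r * exp (r * t) + F t"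
    by (rule DERIV_nonneg_imp_nondecreasing[OF t]) (use nonneg(2) DERIV_add[OF D F] in blast)
  ultimately have *: "\<bar>F t\<bar> \<le> \<bar>F 0\<bar> + (C / r * exp (r * t) - C / r)"
    by (simp add: abs_le_iff abs_if)
  have "C / r * exp (r * t) - C / r \<le> C / \<bar>r\<bar> * exp (max r 0 * t)"
  proof (cases "r > 0")
    case True
    then show ?thesis using C by simp
  next
    case False
    then have "r < 0" using r by simp
    then have "C / r * exp (r * t) \<le> 0" using C by (simp add: divide_nonneg_neg mult_nonpos_nonneg)
    then show ?thesis using \<open>r < 0\<close> by simp
  qed
  moreover have "\<bar>F 0\<bar> * 1 \<le> \<bar>F 0\<bar> * exp (max r 0 * t)"
    using t by (intro mult_left_mono) auto
  ultimately show ?thesis using * by (simp add: distrib_right)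
qed

lemma growth_antiderivative:
  assumes F: "\<And>t. (F has_real_derivative f t) (at t)" and f: "growth r f" and r: "r \<noteq> 0"
  shows "growth (max r 0) F"
proof -
  obtain C where C: "\<And>t. \<bar>f t\<bar> \<le> C * exp (r * \<bar>t\<bar>)" using growthE[OF f] by blast
  have F': "((\<lambda>x. F (- x)) has_real_derivative - f (- x)) (at x)" for x
    using DERIV_chain2[OF F DERIV_minus[OF DERIV_ident], of x] by simp
  have "\<bar>F t\<bar> \<le> (\<bar>F 0\<bar> + C / \<bar>r\<bar>) * exp (max r 0 * \<bar>t\<bar>)" for t
  proof (cases "t \<ge> 0")
    case True
    then show ?thesis
      using growth_antiderivative_aux[OF F _ r True, of C] C by (metis abs_of_nonneg)
  next
    case False
    have "\<bar>- f (- x)\<bar> \<le> C * exp (r * x)" if "x \<ge> 0" for x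
      using C[of "- x"] that by simp
    from growth_antiderivative_aux[OF F' this r, of "- t"] False show ?thesis by simp
  qed
  then show ?thesis unfolding growth_def by blast
qed

section \<open>Fundamental solutions and variation of constants\<close>

definition kink1 :: "real \<Rightarrow> real \<Rightarrow> real" where
  "kink1 s t = 1 - (tanh (t + s))\<^sup>2"

definition kink1' :: "real \<Rightarrow> real \<Rightarrow> real" where
  "kink1' s t = - 2 * tanh (t + s) * (1 - (tanh (t + s))\<^sup>2)"

text \<open>By reduction of order the second solution is \<open>kink1 * \<integral> 1 / kink1\<^sup>2\<close>, where
  \<open>1 / kink1\<^sup>2 = cosh\<^sup>4\<close>.\<close>

definition kink2 :: "real \<Rightarrow> real \<Rightarrow> real" where
  "kink2 s t = sinh (2 * (t + s)) / 8 + 3 / 8 * tanh (t + s) + 3 / 8 * ((t + s) * kink1 s t)"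

definition kink2' :: "real \<Rightarrow> real \<Rightarrow> real" where
  "kink2' s t = cosh (2 * (t + s)) / 4 + 3 / 4 * kink1 s t - 3 / 4 * (t + s) * tanh (t + s) * kink1 s t"

text \<open>Carrying the derivative as an explicit function turns the equation into a first-order
  system, so solutions combine without any computation of \<open>deriv\<close>.\<close>

definition lin_sol ::
    "real \<Rightarrow> (real \<Rightarrow> real) \<Rightarrow> (real \<Rightarrow> real) \<Rightarrow> (real \<Rightarrow> real) \<Rightarrow> bool" where
  "lin_sol s f v v' \<longleftrightarrow> (\<forall>t. (v has_real_derivative v' t) (at t)) \<and>
     (\<forall>t. (v' has_real_derivative (6 * (tanh (t + s))\<^sup>2 - 2) * v t + f t) (at t))"

text \<open>With these identities the checks of the equation for \<open>kink2\<close> and of the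
  Wronskian become polynomial identities in the hyperbolic functions and t + s.\<close>

lemma cosh_sinh_double_tanh:
  fixes x :: real
  shows "(1 - (tanh x)\<^sup>2) * sinh (2 * x) = 2 * tanh x" "(1 - (tanh x)\<^sup>2) * cosh (2 * x) = 1 + (tanh x)\<^sup>2"
    "1 - (tanh x)\<^sup>2 = 1 / (cosh x)\<^sup>2"
proof -
  have c: "cosh x \<noteq> 0" using cosh_real_pos[of x] by simp
  have "1 - (tanh x)\<^sup>2 = ((cosh x)\<^sup>2 - (sinh x)\<^sup>2) / (cosh x)\<^sup>2"
    using c by (simp add: tanh_def power_divide diff_divide_distrib)
  then have 1: "1 - (tanh x)\<^sup>2 = 1 / (cosh x)\<^sup>2"
    by (simp only: hyperbolic_pythagoras)
  then show "1 - (tanh x)\<^sup>2 = 1 / (cosh x)\<^sup>2" .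
  show "(1 - (tanh x)\<^sup>2) * sinh (2 * x) = 2 * tanh x"
    unfolding 1 sinh_double using c by (simp add: tanh_def power2_eq_square)
  show "(1 - (tanh x)\<^sup>2) * cosh (2 * x) = 1 + (tanh x)\<^sup>2"
    unfolding 1 cosh_double using c by (simp add: tanh_def power_divide add_divide_distrib)
qed

lemma DERIV_tanh_shift: "((\<lambda>t. tanh (t + s)) has_real_derivative kink1 s t) (at t)"
  using cosh_real_pos[of "t + s"] by (auto intro!: derivative_eq_intros simp: kink1_def)

lemma DERIV_shift_id: "((\<lambda>t. t + s) has_real_derivative 1) (at t)"
  by (auto intro!: derivative_eq_intros)

lemma DERIV_sinh_shift: "((\<lambda>t. sinh (2 * (t + s))) has_real_derivative 2 * cosh (2 * (t + s))) (at t)"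
  for s t :: real
  by (auto intro!: derivative_eq_intros)

lemma DERIV_cosh_shift: "((\<lambda>t. cosh (2 * (t + s))) has_real_derivative 2 * sinh (2 * (t + s))) (at t)"
  for s t :: real
  by (auto intro!: derivative_eq_intros)

lemma DERIV_kink1: "(kink1 s has_real_derivative kink1' s t) (at t)"
proof -
  have "((\<lambda>t. 1 - (tanh (t + s))\<^sup>2) has_real_derivative 0 - 2 * tanh (t + s) ^ (2 - 1) * kink1 s t) (at t)"
    by (rule DERIV_cong, (rule derivative_intros DERIV_tanh_shift)+) simp
  then show ?thesis by (simp add: kink1_def[abs_def] kink1'_def)
qed

lemma DERIV_kink1': "(kink1' s has_real_derivative (6 * (tanh (t + s))\<^sup>2 - 2) * kink1 s t) (at t)"
proof -
  have "((\<lambda>t. - 2 * tanh (t + s) * kink1 s t) has_real_derivative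
      (6 * (tanh (t + s))\<^sup>2 - 2) * kink1 s t) (at t)"
    by (rule DERIV_cong, (rule derivative_eq_intros DERIV_tanh_shift DERIV_kink1 refl)+)
      (simp add: kink1_def kink1'_def power2_eq_square algebra_simps)
  then show ?thesis by (simp add: kink1_def[abs_def] kink1'_def[abs_def])
qed

lemma DERIV_kink2: "(kink2 s has_real_derivative kink2' s t) (at t)"
proof -
  have "((\<lambda>t. sinh (2 * (t + s)) / 8 + 3 / 8 * tanh (t + s) + 3 / 8 * ((t + s) * kink1 s t))
      has_real_derivative kink2' s t) (at t)"
    by (rule DERIV_cong, rule DERIV_add[OF DERIV_add[OF DERIV_cdivide[OF DERIV_sinh_shift]
          DERIV_cmult[OF DERIV_tanh_shift]] DERIV_cmult[OF DERIV_mult[OF DERIV_shift_id DERIV_kink1]]])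
      (simp add: kink2'_def kink1_def kink1'_def field_simps)
  then show ?thesis by (simp add: kink2_def[abs_def])
qed

lemma DERIV_kink2': "(kink2' s has_real_derivative (6 * (tanh (t + s))\<^sup>2 - 2) * kink2 s t) (at t)"
proof -
  have "((\<lambda>t. cosh (2 * (t + s)) / 4 + 3 / 4 * kink1 s t - 3 / 4 * (t + s) * tanh (t + s) * kink1 s t)
      has_real_derivative sinh (2 * (t + s)) / 2 + 3 / 4 * kink1' s t
       - 3 / 4 * (tanh (t + s) * kink1 s t + (t + s) * (kink1 s t * kink1 s t + tanh (t + s) * kink1' s t))) (at t)"
    by (rule DERIV_cong, rule DERIV_diff[OF DERIV_add[OF DERIV_cdivide[OF DERIV_cosh_shift]
          DERIV_cmult[OF DERIV_kink1]]
          DERIV_mult[OF DERIV_mult[OF DERIV_cmult[OF DERIV_shift_id] DERIV_tanh_shift] DERIV_kink1]])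
      (simp add: field_simps)
  moreover have "sinh (2 * (t + s)) / 2 + 3 / 4 * kink1' s t
       - 3 / 4 * (tanh (t + s) * kink1 s t + (t + s) * (kink1 s t * kink1 s t + tanh (t + s) * kink1' s t))
     = (6 * (tanh (t + s))\<^sup>2 - 2) * kink2 s t"
  proof -
    \<comment> \<open>A polynomial identity with S, T, x for \<open>sinh (2 * (t + s))\<close>,
      \<open>tanh (t + s)\<close>, \<open>t + s\<close>; its last summand vanishes by the
      double-angle relation.\<close>
    have "S / 2 + 3 / 4 * (- 2 * T * (1 - T\<^sup>2)) - 3 / 4 * (T * (1 - T\<^sup>2) +
          x * ((1 - T\<^sup>2) * (1 - T\<^sup>2) + T * (- 2 * T * (1 - T\<^sup>2)))) =
        (6 * T\<^sup>2 - 2) * (S / 8 + 3 / 8 * T + 3 / 8 * (x * (1 - T\<^sup>2))) + 3 / 4 * ((1 - T\<^sup>2) * S - 2 * T)"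
      for S T x :: real
      by (simp add: power2_eq_square field_simps)
    then show ?thesis
      unfolding kink2_def kink1_def kink1'_def cosh_sinh_double_tanh(1)
      using cosh_sinh_double_tanh(1)[of "t + s"] by simp
  qed
  ultimately show ?thesis by (simp add: kink2'_def[abs_def])
qed

text \<open>The equation has no first-order term, so the Wronskian is constant; the normalisation of
  \<open>kink2\<close> in the reduction of order makes it 1 and keeps variation of constants free of
  denominators.\<close>

lemma kink_wronskian: "kink1 s t * kink2' s t - kink1' s t * kink2 s t = 1"
proof -
  have eq: "(1 - T\<^sup>2) * (C / 4 + 3 / 4 * (1 - T\<^sup>2) - 3 / 4 * x * T * (1 - T\<^sup>2)) -
      - 2 * T * (1 - T\<^sup>2) * (S / 8 + 3 / 8 * T + 3 / 8 * (x * (1 - T\<^sup>2))) =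
      1 + 1 / 4 * ((1 - T\<^sup>2) * C - (1 + T\<^sup>2)) + T / 4 * ((1 - T\<^sup>2) * S - 2 * T)"
    for C S T x :: real
    by (simp add: power2_eq_square field_simps)
  show ?thesis
    unfolding kink2_def kink2'_def kink1_def kink1'_def eq
    by (simp only: cosh_sinh_double_tanh(1,2)) simp
qed

lemma lin_sol_kink: "lin_sol s (\<lambda>_. 0) (\<lambda>t. \<alpha> * kink1 s t + \<beta> * kink2 s t) (\<lambda>t. \<alpha> * kink1' s t + \<beta> * kink2' s t)"
  unfolding lin_sol_def
proof (intro conjI allI)
  fix t
  show "((\<lambda>t. \<alpha> * kink1 s t + \<beta> * kink2 s t) has_real_derivative \<alpha> * kink1' s t + \<beta> * kink2' s t) (at t)"
    by (intro DERIV_add DERIV_cmult DERIV_kink1 DERIV_kink2)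
  show "((\<lambda>t. \<alpha> * kink1' s t + \<beta> * kink2' s t) has_real_derivative
      (6 * (tanh (t + s))\<^sup>2 - 2) * (\<alpha> * kink1 s t + \<beta> * kink2 s t) + 0) (at t)"
    by (rule DERIV_cong, (rule DERIV_add DERIV_cmult DERIV_kink1' DERIV_kink2')+) (simp add: algebra_simps)
qed

lemma lin_sol_add:
  assumes "lin_sol s f v v'" "lin_sol s g w w'"
  shows "lin_sol s (\<lambda>t. f t + g t) (\<lambda>t. v t + w t) (\<lambda>t. v' t + w' t)"
  unfolding lin_sol_def
proof (intro conjI allI)
  fix t
  show "((\<lambda>t. v t + w t) has_real_derivative v' t + w' t) (at t)"
    using assms unfolding lin_sol_def by (intro DERIV_add) auto
  have "((\<lambda>t. v' t + w' t) has_real_derivative ((6 * (tanh (t + s))\<^sup>2 - 2) * v t + f t) +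
     ((6 * (tanh (t + s))\<^sup>2 - 2) * w t + g t)) (at t)"
    using assms unfolding lin_sol_def by (intro DERIV_add) auto
  then show "((\<lambda>t. v' t + w' t) has_real_derivative (6 * (tanh (t + s))\<^sup>2 - 2) * (v t + w t) + (f t + g t)) (at t)"
    by (simp add: algebra_simps)
qed

lemma lin_sol_minus: "lin_sol s f v v' \<Longrightarrow> lin_sol s (\<lambda>t. - f t) (\<lambda>t. - v t) (\<lambda>t. - v' t)"
  by (auto simp: lin_sol_def intro!: DERIV_cong[OF DERIV_minus])

text \<open>P and Q are the Wronskian expressions of v with \<open>kink1\<close> and
  \<open>kink2\<close>. Their derivatives lose all terms except the forcing, and v is recovered
  because the Wronskian of the two kinks is 1. Thus every solution has this form.\<close>

lemma lin_sol_representation: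
  assumes "lin_sol s f v v'"
  shows "\<exists>P Q. (\<forall>t. (P has_real_derivative - f t * kink1 s t) (at t)) \<and>
    (\<forall>t. (Q has_real_derivative - f t * kink2 s t) (at t)) \<and> v = (\<lambda>t. Q t * kink1 s t - P t * kink2 s t)"
proof (intro exI conjI allI)
  note d = assms[unfolded lin_sol_def]
  fix t
  show "((\<lambda>t. v t * kink1' s t - v' t * kink1 s t) has_real_derivative - f t * kink1 s t) (at t)"
    by (rule DERIV_cong, (rule DERIV_diff DERIV_mult DERIV_kink1 DERIV_kink1'
        d[THEN conjunct1, rule_format] d[THEN conjunct2, rule_format])+) (simp add: algebra_simps)
  show "((\<lambda>t. v t * kink2' s t - v' t * kink2 s t) has_real_derivative - f t * kink2 s t) (at t)"
    by (rule DERIV_cong, (rule DERIV_diff DERIV_mult DERIV_kink2 DERIV_kink2'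
        d[THEN conjunct1, rule_format] d[THEN conjunct2, rule_format])+) (simp add: algebra_simps)
next
  have "v t = (v t * kink2' s t - v' t * kink2 s t) * kink1 s t -
      (v t * kink1' s t - v' t * kink1 s t) * kink2 s t" for t
  proof -
    have "v t = v t * (kink1 s t * kink2' s t - kink1' s t * kink2 s t)"
      using kink_wronskian[of s t] by simp
    then show ?thesis by (simp add: algebra_simps)
  qed
  then show "v = (\<lambda>t. (v t * kink2' s t - v' t * kink2 s t) * kink1 s t -
      (v t * kink1' s t - v' t * kink1 s t) * kink2 s t)" by blast
qed

lemma continuous_antiderivative:
  fixes f :: "real \<Rightarrow> real"
  assumes "\<And>t. isCont f t"
  shows "\<exists>F. \<forall>t. (F has_real_derivative f t) (at t)"
  using einterval_antiderivative[of "-\<infinity>" "\<infinity>" f] assms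
  by (auto simp: has_real_derivative_iff_has_vector_derivative)

text \<open>In the first derivative the terms with P' and Q' cancel; in the second they combine to f
  times the Wronskian.\<close>

lemma lin_sol_exists:
  assumes f: "\<And>t. isCont f t"
  shows "\<exists>v v'. lin_sol s f v v'"
proof -
  have c1: "isCont (kink1 s) t" and c2: "isCont (kink2 s) t" for t
    using DERIV_kink1 DERIV_kink2 DERIV_isCont by blast+
  obtain P where P: "\<And>t. (P has_real_derivative - f t * kink1 s t) (at t)"
    using continuous_antiderivative[of "\<lambda>t. - f t * kink1 s t"] isCont_mult[OF isCont_minus[OF f] c1] by blast
  obtain Q where Q: "\<And>t. (Q has_real_derivative - f t * kink2 s t) (at t)"
    using continuous_antiderivative[of "\<lambda>t. - f t * kink2 s t"] isCont_mult[OF isCont_minus[OF f] c2] by blast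
  have "lin_sol s f (\<lambda>t. Q t * kink1 s t - P t * kink2 s t) (\<lambda>t. Q t * kink1' s t - P t * kink2' s t)"
    unfolding lin_sol_def
  proof (intro conjI allI)
    fix t
    show "((\<lambda>t. Q t * kink1 s t - P t * kink2 s t) has_real_derivative Q t * kink1' s t - P t * kink2' s t) (at t)"
      by (rule DERIV_cong, (rule DERIV_diff DERIV_mult DERIV_kink1 DERIV_kink2 P Q)+) (simp add: algebra_simps)
    show "((\<lambda>t. Q t * kink1' s t - P t * kink2' s t) has_real_derivative
        (6 * (tanh (t + s))\<^sup>2 - 2) * (Q t * kink1 s t - P t * kink2 s t) + f t) (at t)"
    proof (rule DERIV_cong, (rule DERIV_diff DERIV_mult DERIV_kink1' DERIV_kink2' P Q)+)
      have "f t = f t * (kink1 s t * kink2' s t - kink1' s t * kink2 s t)"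
        using kink_wronskian[of s t] by simp
      then show "- f t * kink2 s t * kink1' s t + (6 * (tanh (t + s))\<^sup>2 - 2) * kink1 s t * Q t -
          (- f t * kink1 s t * kink2' s t + (6 * (tanh (t + s))\<^sup>2 - 2) * kink2 s t * P t) =
          (6 * (tanh (t + s))\<^sup>2 - 2) * (Q t * kink1 s t - P t * kink2 s t) + f t"
        by (simp add: algebra_simps)
    qed
  qed
  then show ?thesis by blast
qed

lemma lin_sol_homogeneous:
  assumes "lin_sol s (\<lambda>_. 0) v v'"
  shows "\<exists>\<alpha> \<beta>. v = (\<lambda>t. \<alpha> * kink1 s t + \<beta> * kink2 s t)"
proof -
  obtain P Q where P: "\<And>t. (P has_real_derivative 0) (at t)" and Q: "\<And>t. (Q has_real_derivative 0) (at t)"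
    and v: "v = (\<lambda>t. Q t * kink1 s t - P t * kink2 s t)"
    using lin_sol_representation[OF assms] by auto
  have "P t = P 0" "Q t = Q 0" for t
    using DERIV_isconst_all P Q by blast+
  then have "v = (\<lambda>t. Q 0 * kink1 s t + (- P 0) * kink2 s t)"
    unfolding v by (intro ext) (metis add_uminus_conv_diff mult_minus_left)
  then show ?thesis by blast
qed

section \<open>Expansions and growth of the fundamental solutions\<close>

lemma exp_poly_sum: "(\<And>i. i \<in> I \<Longrightarrow> exp_poly \<omega> (p i)) \<Longrightarrow> exp_poly \<omega> (\<lambda>t. \<Sum>i\<in>I. p i t)"
  by (induction I rule: infinite_finite_induct) (auto intro: exp_poly.add exp_poly_const)

lemma tanh_exp: "tanh x = 1 - 2 / (1 + exp (2 * x))" for x :: real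
proof -
  define y where "y = exp (2 * x)"
  have y: "y > 0" by (simp add: y_def)
  have "exp (- 2 * x) = 1 / y" by (simp add: y_def exp_minus inverse_eq_divide)
  then have "tanh x = (1 - 1 / y) / (1 + 1 / y)" by (simp only: tanh_real_altdef)
  also have "1 - 1 / y = (y - 1) / y" using y by (simp add: field_simps)
  also have "1 + 1 / y = (1 + y) / y" using y by (simp add: field_simps)
  also have "((y - 1) / y) / ((1 + y) / y) = (y - 1) / (1 + y)" using y by simp
  also have "\<dots> = 1 - 2 / (1 + y)" using y by (simp add: field_simps)
  finally show ?thesis by (simp only: y_def)
qed

text \<open>With \<open>y = exp (2 * (t + s))\<close>, tanh is \<open>1 - 2 / (1 + y)\<close>, and
  the geometric series in - y has an exact remainder of order \<open>y ^ M\<close>.\<close>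

lemma expandable_tanh: "expandable \<omega> (\<lambda>t. tanh (t + s))"
  unfolding expandable_def
proof
  fix N :: int
  \<comment> \<open>This choice gives 2 * M > N, where \<open>y ^ M\<close> has the order of
    \<open>exp (2 * M * t)\<close>.\<close>
  define M where "M = Suc (nat \<bar>N\<bar>)"
  define y where "y t = exp (2 * s) * exp (2 * t)" for t :: real
  have y: "y t > 0" for t by (simp add: y_def)
  have ypow: "y t ^ j = exp (2 * s) ^ j * exp (of_int (2 * int j) * t)" for t j
    by (simp add: y_def power_mult_distrib exp_of_nat_mult[symmetric] mult_ac)
  have tanh: "tanh (t + s) - (1 + - 2 * (\<Sum>j<M. (- y t) ^ j)) = - 2 * (- y t) ^ M / (1 + y t)" for t
  proof -
    have 1: "tanh (t + s) = 1 - 2 / (1 + y t)"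
      unfolding tanh_exp y_def by (simp add: exp_add distrib_left mult.commute)
    have "(1 - (- y t)) * (\<Sum>j<M. (- y t) ^ j) = 1 - (- y t) ^ M"
      by (rule one_diff_power_eq[symmetric])
    then have "(\<Sum>j<M. (- y t) ^ j) = (1 - (- y t) ^ M) / (1 + y t)"
      using y[of t] by (simp add: field_simps)
    then show ?thesis unfolding 1 by (simp add: diff_divide_distrib)
  qed
  have "exp_poly \<omega> (\<lambda>t. 1 + - 2 * (\<Sum>j<M. ((- 1) ^ j * exp (2 * s) ^ j) * exp (of_int (2 * int j) * t)))"
    by (intro exp_poly.add exp_poly_const exp_poly_scale exp_poly_sum exp_poly_exp)
  then have "exp_poly \<omega> (\<lambda>t. 1 + - 2 * (\<Sum>j<M. (- y t) ^ j))"
    unfolding power_minus[of "y _"] ypow mult.assoc .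
  moreover have "(\<lambda>t. - 2 * (- y t) ^ M / (1 + y t)) \<in> O[at_bot](\<lambda>t. exp (of_int (2 * int M) * t))"
  proof (rule landau_o.bigI[of "2 * exp (2 * s) ^ M"])
    show "\<forall>\<^sub>F t in at_bot. norm (- 2 * (- y t) ^ M / (1 + y t)) \<le>
        2 * exp (2 * s) ^ M * norm (exp (of_int (2 * int M) * t))"
    proof (intro always_eventually allI)
      fix t
      have "norm (- 2 * (- y t) ^ M / (1 + y t)) = 2 * y t ^ M / (1 + y t)"
        using y[of t] by (simp add: abs_mult power_abs)
      also have "\<dots> \<le> 2 * y t ^ M / 1"
        using y[of t] by (intro divide_left_mono) auto
      finally show "norm (- 2 * (- y t) ^ M / (1 + y t)) \<le>
        2 * exp (2 * s) ^ M * norm (exp (of_int (2 * int M) * t))"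
        unfolding ypow by simp
    qed
  qed simp
  then have "(\<lambda>t. - 2 * (- y t) ^ M / (1 + y t)) \<in> o[at_bot](\<lambda>t. exp (of_int N * t))"
    by (rule landau_o.big_small_trans, intro exp_smallo_at_bot) (simp add: M_def)
  ultimately show "\<exists>p. exp_poly \<omega> p \<and> (\<lambda>t. tanh (t + s) - p t) \<in> o[at_bot](\<lambda>t. exp (of_int N * t))"
    by (intro exI[of _ "\<lambda>t. 1 + - 2 * (\<Sum>j<M. (- y t) ^ j)"] conjI) (simp_all only: tanh)
qed

lemma expandable_kink1: "expandable \<omega> (kink1 s)"
  unfolding kink1_def[abs_def] power2_eq_square
  by (intro expandable_diff expandable_const expandable_mult expandable_tanh)

lemma expandable_kink2: "expandable \<omega> (kink2 s)"
proof -
  have "exp_poly \<omega> (\<lambda>t. t)"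
    using exp_poly.monomial[of \<omega> 1 1 0 0 0] by simp
  moreover have "(\<lambda>t. sinh (2 * (t + s)) / 8) =
      (\<lambda>t. exp (2 * s) / 16 * exp (of_int 2 * t) - exp (- 2 * s) / 16 * exp (of_int (- 2) * t))"
    by (auto simp: sinh_def exp_add[symmetric] distrib_left fun_eq_iff diff_divide_distrib add.commute)
  then have "expandable \<omega> (\<lambda>t. sinh (2 * (t + s)) / 8)"
    by (simp only:) (intro expandable_diff exp_poly_imp_expandable exp_poly_exp)
  ultimately show ?thesis
    unfolding kink2_def[abs_def]
    by (intro expandable_add expandable_scale expandable_tanh expandable_mult expandable_kink1 expandable_const exp_poly_imp_expandable[of \<omega> "\<lambda>t. t"])
qed

lemma lin_sol_expandable:
  assumes "lin_sol s f v v'" "expandable \<omega> f"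
  shows "expandable \<omega> v"
proof -
  obtain P Q where P: "\<And>t. (P has_real_derivative - f t * kink1 s t) (at t)"
    and Q: "\<And>t. (Q has_real_derivative - f t * kink2 s t) (at t)"
    and v: "v = (\<lambda>t. Q t * kink1 s t - P t * kink2 s t)"
    using lin_sol_representation[OF assms(1)] by auto
  have "expandable \<omega> (\<lambda>t. - f t)" using expandable_scale[OF assms(2), of "- 1"] by simp
  then show ?thesis
    unfolding v
    by (intro expandable_diff expandable_mult expandable_kink1 expandable_kink2 expandable_antiderivative[OF _ P] expandable_antiderivative[OF _ Q])
qed

lemma exp_abs_shift:
  fixes s t :: real
  shows "exp (2 * \<bar>t + s\<bar>) \<le> exp (2 * \<bar>s\<bar>) * exp (2 * \<bar>t\<bar>)" "exp (- 2 * \<bar>t + s\<bar>) \<le> exp (2 * \<bar>s\<bar>) * exp (- 2 * \<bar>t\<bar>)"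
  using abs_triangle_ineq[of t s] abs_triangle_ineq[of "t + s" "- s"] unfolding exp_add[symmetric] by simp_all

lemma growth_tanh: "growth 0 (\<lambda>t. tanh (t + s))"
  unfolding growth_def using tanh_real_bounds by (intro exI[of _ 1]) (auto simp: abs_le_iff less_imp_le minus_le_iff)

lemma growth_kink1: "growth (- 2) (kink1 s)"
proof -
  have "\<bar>kink1 s t\<bar> \<le> 4 * exp (2 * \<bar>s\<bar>) * exp (- 2 * \<bar>t\<bar>)" for t
  proof -
    have "exp \<bar>t + s\<bar> / 2 \<le> cosh \<bar>t + s\<bar>" by (simp add: cosh_def)
    then have "(exp \<bar>t + s\<bar> / 2)\<^sup>2 \<le> (cosh (t + s))\<^sup>2"
      by (intro power_mono) auto
    moreover have "(exp \<bar>t + s\<bar> / 2)\<^sup>2 = exp (2 * \<bar>t + s\<bar>) / 4"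
      by (simp add: power_divide exp_double)
    ultimately have "1 / (cosh (t + s))\<^sup>2 \<le> 1 / (exp (2 * \<bar>t + s\<bar>) / 4)"
      by (intro divide_left_mono) auto
    also have "\<dots> = 4 * exp (- 2 * \<bar>t + s\<bar>)" by (simp add: exp_minus field_simps)
    also have "\<dots> \<le> 4 * (exp (2 * \<bar>s\<bar>) * exp (- 2 * \<bar>t\<bar>))"
      by (intro mult_left_mono exp_abs_shift) simp
    finally show ?thesis by (simp add: kink1_def cosh_sinh_double_tanh(3))
  qed
  then show ?thesis unfolding growth_def by blast
qed

lemma growth_kink2: "growth 2 (kink2 s)"
proof -
  have "\<bar>sinh (2 * (t + s))\<bar> \<le> exp (2 * \<bar>s\<bar>) * exp (2 * \<bar>t\<bar>)" for t
  proof -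
    have "\<bar>sinh (2 * (t + s))\<bar> = sinh (2 * \<bar>t + s\<bar>)"
      by (metis abs_mult abs_numeral sinh_real_abs)
    also have "\<dots> \<le> exp (2 * \<bar>t + s\<bar>)"
    proof -
      have "- exp x \<le> exp (- x)" for x :: real by (rule order_trans[of _ 0]) auto
      from this[of "- (2 * \<bar>t + s\<bar>)"] this[of "2 * \<bar>t + s\<bar>"] show ?thesis by (simp add: sinh_def)
    qed
    finally show ?thesis using exp_abs_shift(1)[of t s] by linarith
  qed
  then have "growth 2 (\<lambda>t. sinh (2 * (t + s)))" unfolding growth_def by blast
  from growth_scale[OF this, of "1 / 8"] have 1: "growth 2 (\<lambda>t. sinh (2 * (t + s)) / 8)" by simp
  \<comment> \<open>This crude bound on the linear factor suffices, since it meets the decay of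
    \<open>kink1\<close> at the same rate 2.\<close>
  have "\<bar>t\<bar> \<le> 1 * exp (2 * \<bar>t\<bar>)" for t :: real
    using exp_ge_add_one_self[of "2 * \<bar>t\<bar>"] by linarith
  then have t: "growth 2 (\<lambda>t. t)" unfolding growth_def by blast
  have c: "growth 2 (\<lambda>t. s)" by (rule growth_mono[OF growth_const]) simp
  have "growth (2 + - 2) (\<lambda>t. (t + s) * kink1 s t)"
    by (rule growth_mult[OF growth_add[OF t c] growth_kink1])
  then have 2: "growth 0 (\<lambda>t. (t + s) * kink1 s t)" by simp
  then show ?thesis
    unfolding kink2_def[abs_def]
    by (intro growth_add 1 growth_scale growth_mono[OF growth_tanh] growth_mono[OF 2]) auto
qed

text \<open>P has rate \<open>max (r - 2) 0\<close> and is multiplied by \<open>kink2\<close> of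
  rate 2; Q has rate r + 2 and is multiplied by \<open>kink1\<close> of rate -2. The resonance r = 2
  is excluded: there the derivative of P would be merely bounded.\<close>

lemma lin_sol_growth:
  assumes "lin_sol s f v v'" and f: "growth r f" and r: "r \<ge> 0" "r \<noteq> 2"
  shows "growth (max r 2) v"
proof -
  obtain P Q where P: "\<And>t. (P has_real_derivative - f t * kink1 s t) (at t)"
    and Q: "\<And>t. (Q has_real_derivative - f t * kink2 s t) (at t)"
    and v: "v = (\<lambda>t. Q t * kink1 s t + - 1 * (P t * kink2 s t))"
    using lin_sol_representation[OF assms(1)] by auto
  have f': "growth r (\<lambda>t. - f t)" using growth_scale[OF f, of "- 1"] by simp
  have "growth (max (r + - 2) 0) P"
    by (rule growth_antiderivative[OF P growth_mult[OF f' growth_kink1]]) (use r in simp)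
  from growth_mult[OF this growth_kink2] have 1: "growth (max r 2) (\<lambda>t. P t * kink2 s t)"
    by (rule growth_mono) simp
  have "growth (max (r + 2) 0) Q"
    by (rule growth_antiderivative[OF Q growth_mult[OF f' growth_kink2]]) (use r in simp)
  from growth_mult[OF this growth_kink1] have 2: "growth (max r 2) (\<lambda>t. Q t * kink1 s t)"
    by (rule growth_mono) (use r in simp)
  show ?thesis unfolding v by (intro growth_add growth_scale 1 2)
qed

section \<open>Constant coefficients at the powers 2 and -2 as coordinates\<close>

lemma has_expansion_leading:
  assumes u: "has_expansion \<omega> k\<^sub>0 q c u"
    and o: "(\<lambda>t. u t - a * exp (of_int j * t)) \<in> o[at_bot](\<lambda>t. exp (of_int j * t))"
  shows "c j = a" "k < j \<Longrightarrow> c k = 0"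
  using has_expansion_small(2)[OF has_expansion_diff[OF u has_expansion_exp[of \<omega> j a]] o, of j]
    has_expansion_small(2)[OF has_expansion_diff[OF u has_expansion_exp[of \<omega> j a]] o, of k] by auto

lemma exp_shift_tendsto_at_bot: "((\<lambda>t. exp (2 * (t + s))) \<longlongrightarrow> 0) at_bot" for s :: real
  using tendsto_mult_left[OF power_times_exp_at_bot[of 2 0], of "exp (2 * s)"]
  by (simp add: exp_add distrib_left mult.commute)

lemma kink1_tendsto: "(kink1 s \<longlongrightarrow> 0) at_bot"
proof -
  have "filterlim (\<lambda>t. t + s) at_bot at_bot" by real_asymp
  from filterlim_compose[OF tanh_real_at_bot this]
  have "((\<lambda>t. 1 - (tanh (t + s))\<^sup>2) \<longlongrightarrow> 1 - (- 1)\<^sup>2) at_bot"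
    by (intro tendsto_intros)
  then show ?thesis by (simp add: kink1_def[abs_def])
qed

text \<open>With \<open>y = exp (2 * (t + s))\<close>, \<open>kink1\<close> is
  \<open>4 * y / (1 + y)\<^sup>2\<close>, so its expansion starts with
  \<open>4 * exp (2 * s)\<close> at the power 2 and has nothing below.\<close>

lemma kink1_left:
  "\<exists>k\<^sub>0 q c. has_expansion \<omega> k\<^sub>0 q c (kink1 s) \<and> c 2 \<noteq> 0 \<and> c (- 2) = 0"
proof -
  obtain k\<^sub>0 q c where e: "has_expansion \<omega> k\<^sub>0 q c (kink1 s)" using expandable_has_expansion[OF expandable_kink1] by blast
  have "(\<lambda>t. kink1 s t - 4 * exp (2 * s) * exp (of_int 2 * t)) \<in> o[at_bot](\<lambda>t. exp (of_int 2 * t))"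
  proof (rule smalloI_tendsto)
    have "((\<lambda>t. 4 * exp (2 * s) * (1 / (1 + exp (2 * (t + s)))\<^sup>2 - 1)) \<longlongrightarrow>
        4 * exp (2 * s) * (1 / (1 + 0)\<^sup>2 - 1)) at_bot"
      by (intro tendsto_intros exp_shift_tendsto_at_bot) simp
    moreover have "(kink1 s t - 4 * exp (2 * s) * exp (of_int 2 * t)) / exp (of_int 2 * t) =
        4 * exp (2 * s) * (1 / (1 + exp (2 * (t + s)))\<^sup>2 - 1)" for t
    proof -
      define y where "y = exp (2 * (t + s))"
      have y: "y > 0" by (simp add: y_def)
      have "tanh (t + s) = 1 - 2 / (1 + y)" by (simp only: tanh_exp y_def)
      moreover have "1 - (1 - 2 / w)\<^sup>2 = 4 * (w - 1) / w\<^sup>2" if "w \<noteq> 0" for w :: real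
        using that by (simp add: field_simps power2_eq_square)
      ultimately have "kink1 s t = 4 * y / (1 + y)\<^sup>2"
        using y by (simp add: kink1_def)
      moreover have "y = exp (2 * s) * exp (2 * t)" by (simp add: y_def exp_add distrib_left)
      ultimately show ?thesis unfolding y_def[symmetric] by (simp add: field_simps)
    qed
    ultimately show "((\<lambda>t. (kink1 s t - 4 * exp (2 * s) * exp (of_int 2 * t)) / exp (of_int 2 * t)) \<longlongrightarrow> 0) at_bot"
      by (simp only:) simp
  qed simp
  from has_expansion_leading[OF e this] have "c 2 \<noteq> 0" "c (- 2) = 0" by auto
  with e show ?thesis by blast
qed

text \<open>The leading term comes from the decreasing exponential of
  \<open>sinh (2 * (t + s)) / 8\<close>; all else is o(\<open>exp (- 2 * t)\<close>). Since
  \<open>kink1\<close> has no coefficient at -2, the matrix of the coefficients of both solutions at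
  -2 and 2 is triangular with nonzero diagonal.\<close>

lemma kink2_left:
  "\<exists>k\<^sub>0 q c. has_expansion \<omega> k\<^sub>0 q c (kink2 s) \<and> c (- 2) \<noteq> 0"
proof -
  obtain k\<^sub>0 q c where e: "has_expansion \<omega> k\<^sub>0 q c (kink2 s)" using expandable_has_expansion[OF expandable_kink2] by blast
  have "(\<lambda>t. kink2 s t - (- exp (- 2 * s) / 16) * exp (of_int (- 2) * t)) \<in> o[at_bot](\<lambda>t. exp (of_int (- 2) * t))"
  proof (rule smalloI_tendsto)
    have "filterlim (\<lambda>t. t + s) at_bot at_bot" by real_asymp
    note tanh = filterlim_compose[OF tanh_real_at_bot this]
    have e0: "((\<lambda>t :: real. exp (2 * t)) \<longlongrightarrow> 0) at_bot" using power_times_exp_at_bot[of 2 0] by simp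
    have "((\<lambda>t :: real. t ^ 1 * exp (2 * t) + s * exp (2 * t)) \<longlongrightarrow> 0 + s * 0) at_bot"
      by (intro tendsto_intros power_times_exp_at_bot e0) simp
    then have e1: "((\<lambda>t. (t + s) * exp (2 * t)) \<longlongrightarrow> 0) at_bot" by (simp add: distrib_right)
    have "((\<lambda>t. exp (2 * (t + s)) / 16 * exp (2 * t) + 3 / 8 * tanh (t + s) * exp (2 * t)
        + 3 / 8 * ((t + s) * exp (2 * t)) * kink1 s t) \<longlongrightarrow> 0 / 16 * 0 + 3 / 8 * (- 1) * 0 + 3 / 8 * 0 * 0) at_bot"
      by (intro tendsto_intros exp_shift_tendsto_at_bot tanh e0 e1 kink1_tendsto) simp
    moreover have "(kink2 s t - (- exp (- 2 * s) / 16) * exp (of_int (- 2) * t)) / exp (of_int (- 2) * t) =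
        exp (2 * (t + s)) / 16 * exp (2 * t) + 3 / 8 * tanh (t + s) * exp (2 * t)
        + 3 / 8 * ((t + s) * exp (2 * t)) * kink1 s t" for t
    proof -
      have "sinh (2 * (t + s)) / 8 + exp (- 2 * s) / 16 * exp (- 2 * t) = exp (2 * (t + s)) / 16"
        by (simp add: sinh_def exp_add[symmetric] distrib_left add.commute diff_divide_distrib)
      then have "kink2 s t - (- exp (- 2 * s) / 16) * exp (of_int (- 2) * t) =
          exp (2 * (t + s)) / 16 + 3 / 8 * tanh (t + s) + 3 / 8 * ((t + s) * kink1 s t)"
        by (simp add: kink2_def)
      moreover have "x / exp (of_int (- 2) * t) = x * exp (2 * t)" for x :: real
        by (simp add: exp_minus divide_inverse)
      moreover have "(a + b + c * ((t + s) * d)) * r = a * r + b * r + c * ((t + s) * r) * d" for a b c d r :: real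
        by (simp add: algebra_simps)
      ultimately show ?thesis by (simp only:)
    qed
    ultimately show "((\<lambda>t. (kink2 s t - (- exp (- 2 * s) / 16) * exp (of_int (- 2) * t)) / exp (of_int (- 2) * t))
        \<longlongrightarrow> 0) at_bot"
      by (simp only:) simp
  qed simp
  from has_expansion_leading(1)[OF e this] have "c (- 2) \<noteq> 0" by auto
  with e show ?thesis by blast
qed

lemma has_expansion_kink_combination_0:
  assumes e: "has_expansion \<omega> k\<^sub>0 q c (\<lambda>t. \<alpha> * kink1 s t + \<beta> * kink2 s t)" and c: "c 2 = 0" "c (- 2) = 0"
  shows "\<alpha> = 0" "\<beta> = 0"
proof -
  obtain k1 q1 c1 where 1: "has_expansion \<omega> k1 q1 c1 (kink1 s)" "c1 2 \<noteq> 0" "c1 (- 2) = 0"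
    using kink1_left by blast
  obtain k2 q2 c2 where 2: "has_expansion \<omega> k2 q2 c2 (kink2 s)" "c2 (- 2) \<noteq> 0"
    using kink2_left by blast
  have eq: "c = (\<lambda>k. \<alpha> * c1 k + \<beta> * c2 k)"
    by (rule has_expansion_unique[OF e has_expansion_add[OF has_expansion_scale[OF 1(1)] has_expansion_scale[OF 2(1)]]])
  from fun_cong[OF eq, of "- 2"] show "\<beta> = 0" using c 1 2 by simp
  with fun_cong[OF eq, of 2] show "\<alpha> = 0" using c 1 2 by simp
qed

lemma lin_sol_adjust:
  assumes v: "lin_sol s f v v'" and f: "expandable \<omega> f"
  shows "\<exists>w w' k\<^sub>0 q c. lin_sol s f w w' \<and> has_expansion \<omega> k\<^sub>0 q c w \<and> c 2 = A \<and> c (- 2) = B"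
proof -
  obtain k1 q1 c1 where 1: "has_expansion \<omega> k1 q1 c1 (kink1 s)" "c1 2 \<noteq> 0" "c1 (- 2) = 0"
    using kink1_left by blast
  obtain k2 q2 c2 where 2: "has_expansion \<omega> k2 q2 c2 (kink2 s)" "c2 (- 2) \<noteq> 0"
    using kink2_left by blast
  obtain k0 q c where e: "has_expansion \<omega> k0 q c v"
    using expandable_has_expansion[OF lin_sol_expandable[OF v f]] by blast
  \<comment> \<open>Back substitution: only \<open>kink2\<close> reaches the power -2, which fixes
    \<beta>; the power 2 then fixes \<alpha>.\<close>
  define \<beta> where "\<beta> = (B - c (- 2)) / c2 (- 2)"
  define \<alpha> where "\<alpha> = (A - c 2 - \<beta> * c2 2) / c1 2"
  note sol = lin_sol_add[OF v lin_sol_kink[of s \<alpha> \<beta>]]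
  note ex = has_expansion_add[OF e has_expansion_add[OF has_expansion_scale[OF 1(1), of \<alpha>] has_expansion_scale[OF 2(1), of \<beta>]]]
  have "c 2 + (\<alpha> * c1 2 + \<beta> * c2 2) = A" "c (- 2) + (\<alpha> * c1 (- 2) + \<beta> * c2 (- 2)) = B"
    using 1 2 by (simp_all add: \<alpha>_def \<beta>_def)
  with sol ex show ?thesis by (simp only: add_0_right) blast
qed

section \<open>The hierarchy of coefficient equations\<close>

text \<open>The cube as a formal power series gives binomial expansion; the double sum in
  \<open>cubic_eq_sum\<close> gives closure under regularity properties.\<close>

definition cubic :: "(nat \<Rightarrow> real) \<Rightarrow> nat \<Rightarrow> real" where
  "cubic c n = fps_nth (Abs_fps c ^ 3) n"

lemma cubic_eq_sum: "cubic c n = (\<Sum>i\<le>n. (\<Sum>j\<le>i. c j * c (i - j)) * c (n - i))"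
  by (simp add: cubic_def power3_eq_cube fps_mult_nth atLeast0AtMost)

lemma cubic_cong: "(\<And>i. i \<le> n \<Longrightarrow> c i = c' i) \<Longrightarrow> cubic c n = cubic c' n"
  unfolding cubic_eq_sum by (intro sum.cong arg_cong2[where f = "(*)"]) auto

text \<open>The n-th term enters as a multiple of the n-th power of the variable. For n \<ge> 1 its
  square and cube start at orders 2 * n and 3 * n, so at order n only the linear term of the
  binomial expansion is seen.\<close>

lemma cubic_split:
  assumes n: "n \<ge> 1"
  shows "cubic c n = cubic (c(n := 0)) n + 3 * (c 0)\<^sup>2 * c n"
proof -
  define F where "F = Abs_fps (c(n := 0))"
  have "Abs_fps c = F + fps_X ^ n * fps_const (c n)"
    by (rule fps_ext) (simp add: F_def fps_X_power_mult_nth)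
  moreover have "(F + X * a) ^ 3 = F ^ 3 + X * (3 * a * F\<^sup>2 + X * (3 * a\<^sup>2 * F + X * a ^ 3))"
    for X a :: "real fps"
    by (simp add: power2_eq_square power3_eq_cube algebra_simps)
  ultimately have "Abs_fps c ^ 3 = F ^ 3 + fps_X ^ n * (3 * fps_const (c n) * F\<^sup>2 +
      fps_X ^ n * (3 * (fps_const (c n))\<^sup>2 * F + fps_X ^ n * fps_const (c n) ^ 3))"
    by simp
  then have "cubic c n = fps_nth (F ^ 3) n + 3 * c n * fps_nth (F\<^sup>2) 0"
    using n by (simp add: cubic_def fps_X_power_mult_nth)
  then show ?thesis
    using n by (simp add: cubic_def F_def power2_eq_square)
qed

lemma cubic_0: "cubic c 0 = c 0 ^ 3"
  by (simp add: cubic_eq_sum power3_eq_cube)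

lemma expandable_cubic:
  assumes "\<And>j. j \<le> n \<Longrightarrow> expandable \<omega> (f j)"
  shows "expandable \<omega> (\<lambda>t. cubic (\<lambda>j. f j t) n)"
  unfolding cubic_eq_sum by (intro expandable_sum expandable_mult assms) auto

lemma growth_cubic:
  assumes f: "\<And>j. j \<le> n \<Longrightarrow> growth (2 * real j) (f j)"
  shows "growth (2 * real n) (\<lambda>t. cubic (\<lambda>j. f j t) n)"
  unfolding cubic_eq_sum
proof (intro growth_sum)
  fix i assume i: "i \<in> {..n}"
  have "growth (2 * real i) (\<lambda>t. \<Sum>j\<le>i. f j t * f (i - j) t)"
  proof (intro growth_sum)
    fix j assume j: "j \<in> {..i}"
    then have "growth (2 * real j + 2 * real (i - j)) (\<lambda>t. f j t * f (i - j) t)"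
      using i by (intro growth_mult f) auto
    with j show "growth (2 * real i) (\<lambda>t. f j t * f (i - j) t)" by (simp add: of_nat_diff)
  qed
  then have "growth (2 * real i + 2 * real (n - i)) (\<lambda>t. (\<Sum>j\<le>i. f j t * f (i - j) t) * f (n - i) t)"
    by (intro growth_mult f) auto
  with i show "growth (2 * real n) (\<lambda>t. (\<Sum>j\<le>i. f j t * f (i - j) t) * f (n - i) t)"
    by (simp add: of_nat_diff)
qed

lemma isCont_cubic:
  fixes f :: "nat \<Rightarrow> real \<Rightarrow> real"
  assumes "\<And>j. j \<le> n \<Longrightarrow> isCont (f j) t"
  shows "isCont (\<lambda>t. cubic (\<lambda>j. f j t) n) t"
  unfolding cubic_eq_sum by (intro continuous_sum continuous_mult assms) auto

text \<open>Dropping \<open>U n\<close> from the cubic term removes \<open>3 * (U 0)\<^sup>2 * U n\<close>, which belongs to the linear operator.\<close>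

definition forcing :: "real \<Rightarrow> real \<Rightarrow> (nat \<Rightarrow> real \<Rightarrow> real) \<Rightarrow> nat \<Rightarrow> real \<Rightarrow> real" where
  "forcing \<omega> \<Phi> U n t = 2 * cubic (\<lambda>j. if j = n then 0 else U j t) n + (if n = 1 then cos (\<omega> * t + \<Phi>) else 0)"

lemma forcing_cong:
  assumes "\<And>j. j < n \<Longrightarrow> U j = V j"
  shows "forcing \<omega> \<Phi> U n = forcing \<omega> \<Phi> V n"
  unfolding forcing_def using assms by (intro ext arg_cong2[where f = "(+)"] arg_cong2[where f = "(*)"] cubic_cong) auto

lemma expandable_forcing:
  assumes "\<And>j. j < n \<Longrightarrow> expandable \<omega> (U j)"
  shows "expandable \<omega> (forcing \<omega> \<Phi> U n)"
proof -
  have "exp_poly \<omega> (\<lambda>t. cos (\<omega> * t + \<Phi>))"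
    using exp_poly.monomial[of \<omega> 0 "cos \<Phi>" 1 "- sin \<Phi>" 0] by (simp add: cos_add mult.commute)
  then have "expandable \<omega> (\<lambda>t. if n = 1 then cos (\<omega> * t + \<Phi>) else 0)"
    using exp_poly_imp_expandable expandable_const by (cases "n = 1") auto
  moreover have "expandable \<omega> (\<lambda>t. if j = n then 0 else U j t)" if "j \<le> n" for j
    using that assms[of j] expandable_const by (cases "j = n") auto
  ultimately show ?thesis
    unfolding forcing_def[abs_def] by (intro expandable_add expandable_scale expandable_cubic) auto
qed

lemma isCont_forcing:
  assumes "\<And>j. j < n \<Longrightarrow> isCont (U j) t"
  shows "isCont (forcing \<omega> \<Phi> U n) t"
proof -
  have "isCont (\<lambda>t. if n = 1 then cos (\<omega> * t + \<Phi>) else 0) t"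
    by (cases "n = 1") (auto intro!: continuous_intros)
  moreover have "isCont (\<lambda>t. if j = n then 0 else U j t) t" if "j \<le> n" for j
    using that assms[of j] by (cases "j = n") auto
  ultimately show ?thesis
    unfolding forcing_def[abs_def] by (intro continuous_add continuous_mult continuous_const isCont_cubic) auto
qed

text \<open>At n = 1 every product in the cubic term contains the removed coefficient, so only the
  bounded cosine is left. The rate 0 there, and 2 * n > 2 later, avoid the resonant rate 2.\<close>

lemma growth_forcing:
  assumes n: "n \<ge> 1" and U: "\<And>j. j < n \<Longrightarrow> growth (2 * real j) (U j)"
  shows "growth (if n = 1 then 0 else 2 * real n) (forcing \<omega> \<Phi> U n)"
proof (cases "n = 1")
  case True
  have "cubic (\<lambda>j. if j = 1 then 0 else U j t) 1 = 0" for t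
    by (simp add: cubic_eq_sum)
  then have "\<bar>forcing \<omega> \<Phi> U 1 t\<bar> \<le> 1 * exp (0 * \<bar>t\<bar>)" for t
    by (simp add: forcing_def)
  then show ?thesis using True unfolding growth_def by auto
next
  case False
  have "growth (2 * real j) (\<lambda>t. if j = n then 0 else U j t)" if "j \<le> n" for j
    using that U[of j] growth_0 by (cases "j = n") auto
  then have "growth (2 * real n) (\<lambda>t. 2 * cubic (\<lambda>j. if j = n then 0 else U j t) n)"
    by (intro growth_scale growth_cubic)
  then show ?thesis using False by (simp add: forcing_def[abs_def])
qed

section \<open>The residual as a polynomial in \<epsilon>\<close>

text \<open>Smallness of order n + 1 includes order n, so the constant coefficient vanishes by
  induction; then one factor \<epsilon>, nonzero to the right of 0, cancels on both sides.\<close>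

lemma poly_smallo_iff:
  fixes p :: "real poly"
  shows "poly p \<in> o[at_right 0](\<lambda>\<epsilon>. \<epsilon> ^ n) \<longleftrightarrow> (\<forall>k\<le>n. coeff p k = 0)"
proof (induction n arbitrary: p)
  case 0
  have "(poly p \<longlongrightarrow> coeff p 0) (at_right 0)"
    using tendsto_poly[OF tendsto_ident_at, of p 0 "{0<..}"] by (simp add: poly_0_coeff_0)
  then have "(poly p \<longlongrightarrow> 0) (at_right 0) \<longleftrightarrow> coeff p 0 = 0"
    using tendsto_unique[of "at_right (0::real)" "poly p"] by auto
  moreover have "poly p \<in> o[at_right 0](\<lambda>\<epsilon>. 1) \<longleftrightarrow> (poly p \<longlongrightarrow> 0) (at_right 0)"
    using smalloI_tendsto[of "poly p" "\<lambda>_. 1" "at_right 0"] smalloD_tendsto[of "poly p" "at_right 0" "\<lambda>_. 1"] by auto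
  ultimately show ?case by simp
next
  case (Suc n)
  obtain a q where p: "p = pCons a q" by (cases p)
  have pos: "\<forall>\<^sub>F \<epsilon> :: real in at_right 0. \<epsilon> \<noteq> 0"
    using eventually_at_right_less[of "0::real"] by eventually_elim simp
  have q: "poly (pCons 0 q) \<in> o[at_right 0](\<lambda>\<epsilon>. \<epsilon> ^ Suc n) \<longleftrightarrow> poly q \<in> o[at_right 0](\<lambda>\<epsilon>. \<epsilon> ^ n)"
    using landau_o.small.mult_cancel_left[OF _ pos, of "\<lambda>\<epsilon>. \<epsilon>" "poly q" "\<lambda>\<epsilon>. \<epsilon> ^ n"]
    by (simp add: poly_pCons[abs_def])
  have "a = 0" if "poly p \<in> o[at_right 0](\<lambda>\<epsilon>. \<epsilon> ^ Suc n)"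
  proof -
    have "(\<lambda>\<epsilon>. \<epsilon>) \<in> o[at_right (0::real)](\<lambda>_. 1)"
      by (rule smalloI_tendsto) (simp_all add: tendsto_ident_at)
    from landau_o.small_big_mult[OF this landau_o.big_refl[of "\<lambda>\<epsilon>. \<epsilon> ^ n"]]
    have "(\<lambda>\<epsilon>. \<epsilon> ^ Suc n) \<in> o[at_right (0::real)](\<lambda>\<epsilon>. \<epsilon> ^ n)" by simp
    from landau_o.small_trans[OF that this] have "coeff p 0 = 0" using Suc.IH[of p] by simp
    then show ?thesis by (simp add: p)
  qed
  then have "poly p \<in> o[at_right 0](\<lambda>\<epsilon>. \<epsilon> ^ Suc n) \<longleftrightarrow> a = 0 \<and> poly q \<in> o[at_right 0](\<lambda>\<epsilon>. \<epsilon> ^ n)"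
    using q p by metis
  moreover have "(\<forall>k\<le>Suc n. coeff p k = 0) \<longleftrightarrow> a = 0 \<and> (\<forall>k\<le>n. coeff q k = 0)"
    unfolding p by (auto simp: coeff_pCons less_Suc_eq_0_disj simp flip: less_Suc_eq_le split: nat.splits)
  ultimately show ?case
    using Suc.IH[of q] by metis
qed

text \<open>The coefficient of \<open>\<epsilon> ^ k\<close> in the residual of the partial sum of
  order n. The linear part stops at n, while the cube continues to 3 * n.\<close>

definition residual_coeff :: "real \<Rightarrow> real \<Rightarrow> (nat \<Rightarrow> real \<Rightarrow> real) \<Rightarrow> nat \<Rightarrow> nat \<Rightarrow> real \<Rightarrow> real" where
  "residual_coeff \<omega> \<Phi> U n k t = (if k \<le> n then deriv (deriv (U k)) t + 2 * U k t else 0)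
     - 2 * cubic (\<lambda>j. if j \<le> n then U j t else 0) k - (if k = 1 then cos (\<omega> * t + \<Phi>) else 0)"

lemma deriv_partial_sum:
  assumes "\<And>n t. U n differentiable (at t)"
  shows "deriv (partial_sum U n \<epsilon>) = partial_sum (\<lambda>n. deriv (U n)) n \<epsilon>"
proof
  fix t
  have "((\<lambda>t. \<Sum>k\<le>n. \<epsilon> ^ k * U k t) has_real_derivative (\<Sum>k\<le>n. \<epsilon> ^ k * deriv (U k) t)) (at t)"
    by (intro DERIV_sum DERIV_cmult)
      (use assms in \<open>simp add: DERIV_deriv_iff_real_differentiable\<close>)
  then show "deriv (partial_sum U n \<epsilon>) t = partial_sum (\<lambda>n. deriv (U n)) n \<epsilon> t"
    unfolding partial_sum_def[abs_def] by (rule DERIV_imp_deriv)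
qed

lemma residual_partial_sum:
  assumes U: "\<And>n t. U n differentiable (at t)" "\<And>n t. deriv (U n) differentiable (at t)"
  shows "\<exists>p. (\<forall>\<epsilon>. residual \<omega> \<Phi> \<epsilon> (partial_sum U n \<epsilon>) t = poly p \<epsilon>) \<and>
    (\<forall>k. coeff p k = residual_coeff \<omega> \<Phi> U n k t)"
proof -
  define u where "u = (\<Sum>k\<le>n. monom (U k t) k)"
  define w where "w = (\<Sum>k\<le>n. monom (deriv (deriv (U k)) t + 2 * U k t) k)"
  define p where "p = w - smult 2 (u ^ 3) - monom (cos (\<omega> * t + \<Phi>)) 1"
  have "residual \<omega> \<Phi> \<epsilon> (partial_sum U n \<epsilon>) t = poly p \<epsilon>" for \<epsilon>
    unfolding residual_def deriv_partial_sum[OF U(1)] deriv_partial_sum[OF U(2)] p_def u_def w_def partial_sum_def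
    by (simp add: poly_sum poly_monom sum.distrib distrib_left sum_distrib_left mult_ac)
  moreover have "coeff p k = residual_coeff \<omega> \<Phi> U n k t" for k
  proof -
    have u: "coeff u j = (if j \<le> n then U j t else 0)" for j
      by (simp add: u_def coeff_sum)
    have w: "coeff w j = (if j \<le> n then deriv (deriv (U j)) t + 2 * U j t else 0)" for j
      by (simp add: w_def coeff_sum)
    have "fps_of_poly u = Abs_fps (\<lambda>j. if j \<le> n then U j t else 0)"
      by (simp add: fps_eq_iff u)
    then have "coeff (u ^ 3) k = cubic (\<lambda>j. if j \<le> n then U j t else 0) k"
      unfolding cubic_def by (metis fps_of_poly_nth fps_of_poly_power)
    then show ?thesis by (simp add: p_def w residual_coeff_def)
  qed
  ultimately show ?thesis by blast
qed

text \<open>Three indices of at most n cannot add up to more than 3 * n. The extra 1 accounts for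
  the forcing, which has order 1 even when n = 0.\<close>

lemma residual_coeff_eq_0:
  assumes "k > 3 * n + 1"
  shows "residual_coeff \<omega> \<Phi> U n k t = 0"
proof -
  have "(if j \<le> n then U j t else 0) * (if i - j \<le> n then U (i - j) t else 0) * (if k - i \<le> n then U (k - i) t else 0) = 0"
    if "i \<le> k" "j \<le> i" for i j
    using that assms by auto
  then have "cubic (\<lambda>j. if j \<le> n then U j t else 0) k = 0"
    unfolding cubic_eq_sum sum_distrib_right by (intro sum.neutral ballI) auto
  then show ?thesis using assms by (simp add: residual_coeff_def)
qed

lemma kink_solution_iff_residual_coeff:
  "kink_solution \<omega> \<Phi> s U \<longleftrightarrow>
     (\<forall>n t. U n differentiable (at t) \<and> deriv (U n) differentiable (at t)) \<and>
     (\<forall>n t. \<forall>k\<le>n. residual_coeff \<omega> \<Phi> U n k t = 0) \<and> (\<forall>t. U 0 t = tanh (t + s))"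
proof -
  have *: "(\<lambda>\<epsilon>. residual \<omega> \<Phi> \<epsilon> (partial_sum U n \<epsilon>) t) \<in> o[at 0 within {0<..<\<epsilon>\<^sub>0}](\<lambda>\<epsilon>. \<epsilon> ^ n) \<longleftrightarrow>
      (\<forall>k\<le>n. residual_coeff \<omega> \<Phi> U n k t = 0)"
    if "\<forall>n t. U n differentiable (at t) \<and> deriv (U n) differentiable (at t)" "\<epsilon>\<^sub>0 > 0" for n t \<epsilon>\<^sub>0
  proof -
    note diff = that(1)
    obtain p where p: "\<And>\<epsilon>. residual \<omega> \<Phi> \<epsilon> (partial_sum U n \<epsilon>) t = poly p \<epsilon>"
      "\<And>k. coeff p k = residual_coeff \<omega> \<Phi> U n k t"
      using residual_partial_sum[of U \<omega> \<Phi> n t] diff by metis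
    \<comment> \<open>For each positive \<open>\<epsilon>\<^sub>0\<close> this is the same one-sided
      filter, so the existential quantifier collapses.\<close>
    have "at 0 within {0<..<\<epsilon>\<^sub>0} = at_right 0"
      by (rule at_within_nhd[of _ "{- 1<..<\<epsilon>\<^sub>0}"]) (use \<open>\<epsilon>\<^sub>0 > 0\<close> in auto)
    then show ?thesis using poly_smallo_iff[of p n] by (simp add: p)
  qed
  have "(\<exists>\<epsilon>\<^sub>0>0. \<forall>n t. (\<lambda>\<epsilon>. residual \<omega> \<Phi> \<epsilon> (partial_sum U n \<epsilon>) t)
          \<in> o[at 0 within {0<..<\<epsilon>\<^sub>0}](\<lambda>\<epsilon>. \<epsilon> ^ n)) \<longleftrightarrow>
      (\<forall>n t. \<forall>k\<le>n. residual_coeff \<omega> \<Phi> U n k t = 0)"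
    if "\<forall>n t. U n differentiable (at t) \<and> deriv (U n) differentiable (at t)"
    using *[OF that] by (metis zero_less_one)
  then show ?thesis
    unfolding kink_solution_def asymptotic_solution_def by argo
qed

text \<open>The part of the cube that is linear in \<open>U n\<close> carries the factor 3 T^2;
  doubled and combined with 2 * U n it forms the operator linearised at the kink, and the rest is
  the forcing.\<close>

lemma residual_coeff_diagonal:
  assumes n: "n \<ge> 1" and U0: "U 0 t = tanh (t + s)"
  shows "residual_coeff \<omega> \<Phi> U n n t = 0 \<longleftrightarrow>
    deriv (deriv (U n)) t = (6 * (tanh (t + s))\<^sup>2 - 2) * U n t + forcing \<omega> \<Phi> U n t"
proof -
  have "cubic (\<lambda>j. if j \<le> n then U j t else 0) n = cubic (\<lambda>j. U j t) n"
    by (rule cubic_cong) simp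
  also have "\<dots> = cubic (\<lambda>j. if j = n then 0 else U j t) n + 3 * (tanh (t + s))\<^sup>2 * U n t"
    using cubic_split[OF n, of "\<lambda>j. U j t"] U0 by (simp add: fun_upd_def)
  finally show ?thesis
    unfolding residual_coeff_def forcing_def by (auto simp: algebra_simps)
qed

text \<open>Order k involves no U j with j > k. Longer partial sums thus add no conditions at order
  k, and only the diagonal ones remain.\<close>

lemma residual_coeff_mono:
  assumes "k \<le> n"
  shows "residual_coeff \<omega> \<Phi> U n k t = residual_coeff \<omega> \<Phi> U k k t"
proof -
  have "cubic (\<lambda>j. if j \<le> n then U j t else 0) k = cubic (\<lambda>j. if j \<le> k then U j t else 0) k"
    by (rule cubic_cong) (use assms in simp)
  then show ?thesis using assms by (simp add: residual_coeff_def)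
qed

text \<open>This trades the order symbols for a recursive hierarchy of linear equations, the form in
  which existence, uniqueness and regularity are proved.\<close>

lemma kink_solution_iff:
  "kink_solution \<omega> \<Phi> s U \<longleftrightarrow>
     U 0 = (\<lambda>t. tanh (t + s)) \<and> (\<forall>n\<ge>1. \<exists>v'. lin_sol s (forcing \<omega> \<Phi> U n) (U n) v')"
    (is "?L \<longleftrightarrow> ?R")
proof
  assume ?L
  then have diff: "U n differentiable (at t)" "deriv (U n) differentiable (at t)"
    and coeff: "residual_coeff \<omega> \<Phi> U n n t = 0" and U0: "U 0 t = tanh (t + s)" for n t
    unfolding kink_solution_iff_residual_coeff by auto
  have "lin_sol s (forcing \<omega> \<Phi> U n) (U n) (deriv (U n))" if n: "n \<ge> 1" for n
    unfolding lin_sol_def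
  proof (intro conjI allI)
    fix t
    show "(U n has_real_derivative deriv (U n) t) (at t)"
      using diff(1) by (simp add: DERIV_deriv_iff_real_differentiable)
    have "(deriv (U n) has_real_derivative deriv (deriv (U n)) t) (at t)"
      using diff(2) by (simp add: DERIV_deriv_iff_real_differentiable)
    also have "deriv (deriv (U n)) t = (6 * (tanh (t + s))\<^sup>2 - 2) * U n t + forcing \<omega> \<Phi> U n t"
      using coeff residual_coeff_diagonal[OF n, of U t s] U0 by blast
    finally show "(deriv (U n) has_real_derivative
        (6 * (tanh (t + s))\<^sup>2 - 2) * U n t + forcing \<omega> \<Phi> U n t) (at t)" .
  qed
  with U0 show ?R by auto
next
  assume R: ?R
  have U: "\<exists>v' v''. (\<forall>t. (U n has_real_derivative v' t) (at t)) \<and> (\<forall>t. (v' has_real_derivative v'' t) (at t)) \<and>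
      (\<forall>t. residual_coeff \<omega> \<Phi> U n n t = 0)" for n
  proof (cases "n = 0")
    case True
    have U0: "U 0 = (\<lambda>t. tanh (t + s))" using R by simp
    have "deriv (U 0) = kink1 s" "deriv (kink1 s) = kink1' s"
      unfolding U0 using DERIV_tanh_shift DERIV_kink1 by (auto intro!: DERIV_imp_deriv)
    \<comment> \<open>The order-0 condition is the unperturbed equation T'' + 2 T - 2 T^3 = 0,
      satisfied because T'' = - 2 T (1 - T^2).\<close>
    then have "residual_coeff \<omega> \<Phi> U 0 0 t = 0" for t
      using U0 by (simp add: residual_coeff_def cubic_0 kink1'_def algebra_simps power2_eq_square power3_eq_cube)
    then show ?thesis using True U0 DERIV_tanh_shift DERIV_kink1 by metis
  next
    case False
    then have n: "n \<ge> 1" by simp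
    then obtain v' where v': "\<And>t. (U n has_real_derivative v' t) (at t)"
      "\<And>t. (v' has_real_derivative (6 * (tanh (t + s))\<^sup>2 - 2) * U n t + forcing \<omega> \<Phi> U n t) (at t)"
      using R unfolding lin_sol_def by blast
    have "deriv (U n) = v'" using v'(1) by (auto intro: DERIV_imp_deriv)
    then have d: "deriv (deriv (U n)) t = (6 * (tanh (t + s))\<^sup>2 - 2) * U n t + forcing \<omega> \<Phi> U n t" for t
      using DERIV_imp_deriv[OF v'(2)] by (simp only:)
    have U0: "U 0 t = tanh (t + s)" for t using R by simp
    have "residual_coeff \<omega> \<Phi> U n n t = 0" for t
      by (rule iffD2[OF residual_coeff_diagonal[OF n, of U t s \<omega> \<Phi>, OF U0] d])
    with v' show ?thesis
      by (intro exI[of _ v'] exI[of _ "\<lambda>t. (6 * (tanh (t + s))\<^sup>2 - 2) * U n t + forcing \<omega> \<Phi> U n t"]) simp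
  qed
  have "deriv (U n) = v'" if "\<forall>t. (U n has_real_derivative v' t) (at t)" for n v'
    using that by (auto intro: DERIV_imp_deriv)
  then have "U n differentiable (at t)" "deriv (U n) differentiable (at t)" for n t
    using U[of n] by (metis real_differentiable_def)+
  moreover have "residual_coeff \<omega> \<Phi> U n k t = 0" if "k \<le> n" for n k t
  proof -
    have "residual_coeff \<omega> \<Phi> U k k t = 0" using U[of k] by blast
    then show ?thesis by (simp only: residual_coeff_mono[OF that, of \<omega> \<Phi> U t])
  qed
  ultimately show ?L
    unfolding kink_solution_iff_residual_coeff using R by auto
qed

section \<open>Regularity, uniqueness and existence order by order\<close>

text \<open>At n = 1 the forcing is bounded, and the rate 2 = 2 * n comes from the growing
  homogeneous solution; from n = 2 on the forcing sets the rate.\<close>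

lemma lin_sol_forcing_regular:
  assumes "n \<ge> 1" "lin_sol s (forcing \<omega> \<Phi> U n) v v'"
    and U: "\<And>j. j < n \<Longrightarrow> expandable \<omega> (U j) \<and> growth (2 * real j) (U j)"
  shows "expandable \<omega> v" "growth (2 * real n) v"
proof -
  show "expandable \<omega> v" by (rule lin_sol_expandable[OF assms(2) expandable_forcing]) (use U in blast)
  have "growth (max (if n = 1 then 0 else 2 * real n) 2) v"
    by (rule lin_sol_growth[OF assms(2) growth_forcing]) (use assms(1) U in auto)
  with assms(1) show "growth (2 * real n) v" by (cases "n = 1") auto
qed

text \<open>The regularity is derived for an arbitrary solution, not only a constructed one; hence
  every solution has parameters and is valid in the range.\<close>

lemma kink_solution_regular:
  assumes "kink_solution \<omega> \<Phi> s U"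
  shows "expandable \<omega> (U n) \<and> growth (2 * real n) (U n)"
proof (induction n rule: less_induct)
  case (less n)
  show ?case
  proof (cases "n = 0")
    case True
    then show ?thesis using assms expandable_tanh growth_tanh by (simp add: kink_solution_iff)
  next
    case False
    then have "n \<ge> 1" by simp
    then obtain v' where "lin_sol s (forcing \<omega> \<Phi> U n) (U n) v'"
      using assms unfolding kink_solution_iff by blast
    from lin_sol_forcing_regular[OF \<open>n \<ge> 1\<close> this less] show ?thesis by blast
  qed
qed

lemma growth_bigo_at_bot:
  assumes "growth (2 * real n) u"
  shows "u \<in> O[at_bot](\<lambda>t. exp (- 2 * real n * t))"
proof -
  obtain C where C: "\<And>t. \<bar>u t\<bar> \<le> C * exp (2 * real n * \<bar>t\<bar>)" using growthE[OF assms] by blast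
  have "\<forall>\<^sub>F t in at_bot. norm (u t) \<le> C * norm (exp (- 2 * real n * t))"
    using eventually_le_at_bot[of "0::real"]
  proof eventually_elim
    case (elim t)
    then show ?case using C[of t] by simp
  qed
  then show ?thesis by (rule bigoI)
qed

lemma regular_left_form:
  assumes "expandable \<omega> u" "growth (2 * real n) u" "n \<ge> 1"
  shows "\<exists>A B. left_form \<omega> n A B u"
  using expandable_has_expansion[OF assms(1)] growth_bigo_at_bot[OF assms(2)] by (auto simp: left_form_iff[OF assms(3)])

lemma left_form_unique:
  assumes "n \<ge> 1" "left_form \<omega> n A B u" "left_form \<omega> n A' B' u"
  shows "A = A'" "B = B'"
  using assms(2,3) has_expansion_unique unfolding left_form_iff[OF assms(1)] by metis+

text \<open>The difference solves the homogeneous equation, hence is a combination of the two kinks.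
  Its constant coefficients at 2 and -2 cancel, and these determine the combination.\<close>

lemma left_form_lin_sol_unique:
  assumes n: "n \<ge> 1" and "lin_sol s f u u'" "lin_sol s f v v'"
    and "left_form \<omega> n A B u" "left_form \<omega> n A B v"
  shows "u = v"
proof -
  obtain k q c where u: "has_expansion \<omega> k q c u" "c 2 = A" "c (- 2) = B"
    using assms(4) unfolding left_form_iff[OF n] by blast
  obtain k' q' c' where v: "has_expansion \<omega> k' q' c' v" "c' 2 = A" "c' (- 2) = B"
    using assms(5) unfolding left_form_iff[OF n] by blast
  have "lin_sol s (\<lambda>_. 0) (\<lambda>t. u t - v t) (\<lambda>t. u' t - v' t)"
    using lin_sol_add[OF assms(2) lin_sol_minus[OF assms(3)]] by simp
  then obtain \<alpha> \<beta> where eq: "(\<lambda>t. u t - v t) = (\<lambda>t. \<alpha> * kink1 s t + \<beta> * kink2 s t)"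
    using lin_sol_homogeneous by blast
  have "\<alpha> = 0" "\<beta> = 0"
    using has_expansion_kink_combination_0[OF has_expansion_diff[OF u(1) v(1), unfolded eq]] u v by auto
  with fun_cong[OF eq] show ?thesis by (auto simp: fun_eq_iff)
qed

lemma kink_solution_determined:
  assumes U: "kink_solution \<omega> \<Phi> s U" "left_parameters \<omega> U A B"
    and V: "kink_solution \<omega> \<Phi> s V" "left_parameters \<omega> V A' B'"
    and eq: "\<And>k. k < n \<Longrightarrow> U k = V k" "fps_nth A n = fps_nth A' n" "fps_nth B n = fps_nth B' n"
  shows "U n = V n"
proof (cases "n = 0")
  case True
  then show ?thesis using U V by (simp add: kink_solution_iff)
next
  case False
  then have n: "n \<ge> 1" by simp
  have f: "forcing \<omega> \<Phi> U n = forcing \<omega> \<Phi> V n" using eq(1) by (rule forcing_cong)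
  obtain u' where u': "lin_sol s (forcing \<omega> \<Phi> U n) (U n) u'"
    using U(1) n unfolding kink_solution_iff by blast
  obtain v' where v': "lin_sol s (forcing \<omega> \<Phi> U n) (V n) v'"
    using V(1) n unfolding kink_solution_iff f by blast
  have "left_form \<omega> n (fps_nth A n) (fps_nth B n) (U n)"
    using U(2) n unfolding left_parameters_def by blast
  moreover have "left_form \<omega> n (fps_nth A n) (fps_nth B n) (V n)"
    using V(2) n unfolding left_parameters_def eq by blast
  ultimately show ?thesis
    by (rule left_form_lin_sol_unique[OF n u' v'])
qed

lemma kink_solution_exists:
  assumes "fps_nth A 0 = 0" "fps_nth B 0 = 0"
  shows "\<exists>U. kink_solution \<omega> \<Phi> s U \<and> left_parameters \<omega> U A B"
proof -
  \<comment> \<open>The recursion must carry the regularity along, since the next forcing is built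
    from it. Earlier orders enter P only through the forcing, as well-founded choice
    requires.\<close>
  define P where "P f n r \<longleftrightarrow> expandable \<omega> r \<and> growth (2 * real n) r \<and> (\<forall>t. isCont r t) \<and>
      (if n = 0 then r = (\<lambda>t. tanh (t + s))
       else (\<exists>v'. lin_sol s (forcing \<omega> \<Phi> f n) r v') \<and> left_form \<omega> n (fps_nth A n) (fps_nth B n) r)"
    for f :: "nat \<Rightarrow> real \<Rightarrow> real" and n r
  have "\<exists>U. \<forall>n. P U n (U n)"
  proof (rule dependent_wf_choice[OF wf_less])
    fix f g :: "nat \<Rightarrow> real \<Rightarrow> real" and n r assume "\<And>m. (m, n) \<in> {(x, y). x < y} \<Longrightarrow> f m = g m"
    then have "forcing \<omega> \<Phi> f n = forcing \<omega> \<Phi> g n" by (intro forcing_cong) auto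
    then show "P f n r = P g n r" by (simp add: P_def)
  next
    fix n and f :: "nat \<Rightarrow> real \<Rightarrow> real" assume "\<And>m. (m, n) \<in> {(x, y). x < y} \<Longrightarrow> P f m (f m)"
    then have f: "expandable \<omega> (f m)" "growth (2 * real m) (f m)" "isCont (f m) t" if "m < n" for m t
      using that unfolding P_def by auto
    show "\<exists>r. P f n r"
    proof (cases "n = 0")
      case True
      have "isCont (\<lambda>t. tanh (t + s)) t" for t
        using DERIV_tanh_shift DERIV_isCont by blast
      then show ?thesis using True expandable_tanh growth_tanh by (auto simp: P_def)
    next
      case False
      then have n: "n \<ge> 1" by simp
      have "isCont (forcing \<omega> \<Phi> f n) t" for t by (rule isCont_forcing) (use f in blast)
      then obtain v v' where v: "lin_sol s (forcing \<omega> \<Phi> f n) v v'"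
        using lin_sol_exists by blast
      have "expandable \<omega> (forcing \<omega> \<Phi> f n)" by (rule expandable_forcing) (use f in blast)
      from lin_sol_adjust[OF v this] obtain w w' k q c where w: "lin_sol s (forcing \<omega> \<Phi> f n) w w'"
        and e: "has_expansion \<omega> k q c w" "c 2 = fps_nth A n" "c (- 2) = fps_nth B n" by blast
      note reg = lin_sol_forcing_regular[OF n w]
      have "expandable \<omega> w" "growth (2 * real n) w" using reg f by blast+
      moreover have "left_form \<omega> n (fps_nth A n) (fps_nth B n) w"
        using e growth_bigo_at_bot[OF \<open>growth (2 * real n) w\<close>] by (auto simp: left_form_iff[OF n])
      moreover have "isCont w t" for t
        using w DERIV_isCont unfolding lin_sol_def by blast
      ultimately show ?thesis using w False by (auto simp: P_def)
    qed
  qed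
  then obtain U where U: "\<And>n. P U n (U n)" by blast
  have "U 0 = (\<lambda>t. tanh (t + s))" using U[of 0] by (simp add: P_def)
  moreover have "(\<exists>v'. lin_sol s (forcing \<omega> \<Phi> U n) (U n) v') \<and>
      left_form \<omega> n (fps_nth A n) (fps_nth B n) (U n)" if "n \<ge> 1" for n
    using U[of n] that by (simp add: P_def)
  ultimately have "kink_solution \<omega> \<Phi> s U" "left_parameters \<omega> U A B"
    using assms by (simp_all add: kink_solution_iff left_parameters_def)
  then show ?thesis by blast
qed

section \<open>Uniform estimates in the range of validity\<close>

lemma eventually_validity_range:
  "\<forall>\<^sub>F x in validity_range. snd x > 0"
proof -
  have "\<forall>\<^sub>F g :: real in at_right 0. g > 0" by (rule eventually_at_right_less)
  then have "\<forall>\<^sub>F x in validity_range. (case x of (t, \<epsilon>) \<Rightarrow> \<epsilon> * exp (2 * \<bar>t\<bar>)) > 0"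
    unfolding validity_range_def by (rule eventually_filtercomapI)
  then show ?thesis by eventually_elim (auto simp: zero_less_mult_iff)
qed

text \<open>The rate 2 * n is what merges \<open>\<epsilon> ^ n\<close> and the growth of f into the
  n-th power of the gauge; the constant C does not depend on t.\<close>

lemma growth_validity_range:
  assumes "growth (2 * real n) f"
  shows "(\<lambda>(t, \<epsilon>). \<epsilon> ^ n * f t) \<in> O[validity_range](\<lambda>(t, \<epsilon>). (\<epsilon> * exp (2 * \<bar>t\<bar>)) ^ n)"
proof -
  obtain C where C: "\<And>t. \<bar>f t\<bar> \<le> C * exp (2 * real n * \<bar>t\<bar>)" using growthE[OF assms] by blast
  show ?thesis
  proof (rule bigoI)
    show "\<forall>\<^sub>F x in validity_range. norm (case x of (t, \<epsilon>) \<Rightarrow> \<epsilon> ^ n * f t) \<le>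
        C * norm (case x of (t, \<epsilon>) \<Rightarrow> (\<epsilon> * exp (2 * \<bar>t\<bar>)) ^ n)"
      using eventually_validity_range
    proof eventually_elim
      case (elim x)
      obtain t \<epsilon> where x: "x = (t, \<epsilon>)" by (cases x)
      have "\<bar>\<epsilon> ^ n * f t\<bar> = \<epsilon> ^ n * \<bar>f t\<bar>" using elim x by (simp add: abs_mult)
      also have "\<dots> \<le> \<epsilon> ^ n * (C * exp (2 * real n * \<bar>t\<bar>))"
        using elim x by (intro mult_left_mono C) simp
      also have "exp (2 * real n * \<bar>t\<bar>) = exp (2 * \<bar>t\<bar>) ^ n"
        by (simp add: exp_of_nat_mult[symmetric] mult_ac)
      finally show ?case using elim x by (simp add: power_mult_distrib mult_ac)
    qed
  qed
qed

text \<open>The filter is the pullback of \<open>at_right 0\<close> along the gauge, so the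
  comparison of powers of one variable carries over.\<close>

lemma validity_range_power_smallo:
  assumes "n < k"
  shows "(\<lambda>(t, \<epsilon>). (\<epsilon> * exp (2 * \<bar>t\<bar>)) ^ k) \<in> o[validity_range](\<lambda>(t, \<epsilon>). (\<epsilon> * exp (2 * \<bar>t\<bar>)) ^ n)"
proof -
  have "((\<lambda>g. g ^ (k - n)) \<longlongrightarrow> (0::real) ^ (k - n)) (at_right 0)"
    by (intro tendsto_intros)
  then have "(\<lambda>g :: real. g ^ (k - n)) \<in> o[at_right 0](\<lambda>_. 1)"
    by (intro smalloI_tendsto) (use assms in \<open>simp_all add: power_0_left\<close>)
  from landau_o.small_big_mult[OF this landau_o.big_refl[of "\<lambda>g. g ^ n"]]
  have "(\<lambda>g :: real. g ^ k) \<in> o[at_right 0](\<lambda>g. g ^ n)"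
    using assms by (simp flip: power_add)
  from landau_o.small.compose[OF this filterlim_filtercomap[of "\<lambda>(t, \<epsilon>). \<epsilon> * exp (2 * \<bar>t\<bar>)"]]
  show ?thesis by (simp add: validity_range_def case_prod_unfold)
qed

lemma kink_solution_valid:
  assumes U: "kink_solution \<omega> \<Phi> s U"
  shows "valid_in_range \<omega> \<Phi> U"
  unfolding valid_in_range_def
proof (intro allI conjI)
  fix n
  note reg = kink_solution_regular[OF U]
  show "(\<lambda>(t, \<epsilon>). \<epsilon> ^ n * U n t) \<in> O[validity_range](\<lambda>(t, \<epsilon>). (\<epsilon> * exp (2 * \<bar>t\<bar>)) ^ n)"
    using reg by (intro growth_validity_range) auto
  \<comment> \<open>The equations of the hierarchy cancel the orders up to n, and the degree bound
    cuts off those above 3 * n + 1.\<close>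
  have res: "residual \<omega> \<Phi> \<epsilon> (partial_sum U n \<epsilon>) t =
      (\<Sum>k=n+1..3*n+1. \<epsilon> ^ k * residual_coeff \<omega> \<Phi> U n k t)" for t \<epsilon>
  proof -
    note U' = U[unfolded kink_solution_iff_residual_coeff]
    obtain p where p: "\<And>\<epsilon>. residual \<omega> \<Phi> \<epsilon> (partial_sum U n \<epsilon>) t = poly p \<epsilon>"
      "\<And>k. coeff p k = residual_coeff \<omega> \<Phi> U n k t"
      using residual_partial_sum[of U \<omega> \<Phi> n t] U' by metis
    have "coeff p k = 0" if "k \<notin> {n+1..3*n+1}" for k
    proof (cases "k \<le> n")
      case True
      then show ?thesis using U' by (simp add: p(2))
    next
      case False
      then show ?thesis
        using that residual_coeff_eq_0[of n k \<omega> \<Phi> U t] by (simp add: p(2))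
    qed
    then have "(\<Sum>k\<le>degree p. coeff p k * \<epsilon> ^ k) = (\<Sum>k=n+1..3*n+1. coeff p k * \<epsilon> ^ k)"
      by (intro sum.mono_neutral_cong) (simp_all add: not_le coeff_eq_0)
    then show ?thesis by (simp add: p(1) poly_altdef p(2) mult.commute)
  qed
  \<comment> \<open>Above order n the linear part is absent. What remains are products of U 0, ...,
    U n and, when n = 0, the cosine, so no bound on derivatives enters.\<close>
  have "(\<lambda>(t, \<epsilon>). \<epsilon> ^ k * residual_coeff \<omega> \<Phi> U n k t) \<in> o[validity_range](\<lambda>(t, \<epsilon>). (\<epsilon> * exp (2 * \<bar>t\<bar>)) ^ n)"
    if k: "k \<in> {n+1..3*n+1}" for k
  proof -
    have "growth (2 * real j) (\<lambda>t. if j \<le> n then U j t else 0)" for j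
      using reg[of j] growth_0 by (cases "j \<le> n") auto
    then have "growth (2 * real k) (\<lambda>t. - 2 * cubic (\<lambda>j. if j \<le> n then U j t else 0) k)"
      by (intro growth_scale growth_cubic)
    moreover have "growth 0 (\<lambda>t. - (if k = 1 then cos (\<omega> * t + \<Phi>) else 0))"
      unfolding growth_def by (intro exI[of _ 1]) simp
    then have "growth (2 * real k) (\<lambda>t. - (if k = 1 then cos (\<omega> * t + \<Phi>) else 0))"
      by (rule growth_mono) simp
    ultimately have "growth (2 * real k) (\<lambda>t. - 2 * cubic (\<lambda>j. if j \<le> n then U j t else 0) k +
        - (if k = 1 then cos (\<omega> * t + \<Phi>) else 0))"
      by (rule growth_add)
    moreover have "residual_coeff \<omega> \<Phi> U n k = (\<lambda>t. - 2 * cubic (\<lambda>j. if j \<le> n then U j t else 0) k +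
        - (if k = 1 then cos (\<omega> * t + \<Phi>) else 0))"
      using k by (intro ext) (simp add: residual_coeff_def)
    ultimately have "growth (2 * real k) (residual_coeff \<omega> \<Phi> U n k)" by simp
    from landau_o.big_small_trans[OF growth_validity_range[OF this] validity_range_power_smallo]
    show ?thesis using k by simp
  qed
  then have "(\<lambda>x. \<Sum>k=n+1..3*n+1. case x of (t, \<epsilon>) \<Rightarrow> \<epsilon> ^ k * residual_coeff \<omega> \<Phi> U n k t)
      \<in> o[validity_range](\<lambda>(t, \<epsilon>). (\<epsilon> * exp (2 * \<bar>t\<bar>)) ^ n)"
    by (rule big_sum_in_smallo)
  then show "(\<lambda>(t, \<epsilon>). residual \<omega> \<Phi> \<epsilon> (partial_sum U n \<epsilon>) t) \<in> o[validity_range](\<lambda>(t, \<epsilon>). (\<epsilon> * exp (2 * \<bar>t\<bar>)) ^ n)"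
    by (simp add: res case_prod_unfold)
qed

lemma left_parameters_exists_unique:
  assumes U: "kink_solution \<omega> \<Phi> s U"
  shows "\<exists>!P. left_parameters \<omega> U (fst P) (snd P)"
proof -
  have "\<forall>n. \<exists>A B. n \<ge> 1 \<longrightarrow> left_form \<omega> n A B (U n)"
    using kink_solution_regular[OF U] regular_left_form by blast
  then obtain A B where AB: "\<And>n. n \<ge> 1 \<Longrightarrow> left_form \<omega> n (A n) (B n) (U n)" by metis
  show ?thesis
  proof (rule ex1I)
    show "left_parameters \<omega> U (fst (Abs_fps (A(0 := 0)), Abs_fps (B(0 := 0))))
        (snd (Abs_fps (A(0 := 0)), Abs_fps (B(0 := 0))))"
      using AB by (auto simp: left_parameters_def)
    fix P assume P: "left_parameters \<omega> U (fst P) (snd P)"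
    have "fps_nth (fst P) n = (A(0 := 0)) n" "fps_nth (snd P) n = (B(0 := 0)) n" for n
    proof -
      have "fps_nth (fst P) n = (A(0 := 0)) n \<and> fps_nth (snd P) n = (B(0 := 0)) n"
      proof (cases "n = 0")
        case True
        then show ?thesis using P by (simp add: left_parameters_def)
      next
        case False
        then have n: "n \<ge> 1" by simp
        then have "left_form \<omega> n (fps_nth (fst P) n) (fps_nth (snd P) n) (U n)"
          using P unfolding left_parameters_def by blast
        from left_form_unique[OF n this AB[OF n]] show ?thesis using False by simp
      qed
      then show "fps_nth (fst P) n = (A(0 := 0)) n" "fps_nth (snd P) n = (B(0 := 0)) n" by auto
    qed
    then show "P = (Abs_fps (A(0 := 0)), Abs_fps (B(0 := 0)))"
      by (auto simp: prod_eq_iff fps_eq_iff)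
  qed
qed

theorem theorem1:
  fixes \<omega> \<Phi>\<^sub>0 s :: real
  shows
    "(\<forall>A B. fps_nth A 0 = 0 \<and> fps_nth B 0 = 0 \<longrightarrow>
        (\<exists>!U. kink_solution \<omega> \<Phi>\<^sub>0 s U \<and> left_parameters \<omega> U A B)) \<and>
     (\<forall>U. kink_solution \<omega> \<Phi>\<^sub>0 s U \<longrightarrow>
        valid_in_range \<omega> \<Phi>\<^sub>0 U \<and>
        (\<exists>!P. left_parameters \<omega> U (fst P) (snd P))) \<and>
     (\<forall>U V A B A' B' n.
        kink_solution \<omega> \<Phi>\<^sub>0 s U \<and> left_parameters \<omega> U A B \<and>
        kink_solution \<omega> \<Phi>\<^sub>0 s V \<and> left_parameters \<omega> V A' B' \<and>
        (\<forall>k<n. U k = V k) \<and> fps_nth A n = fps_nth A' n \<and> fps_nth B n = fps_nth B' n \<longrightarrow>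
        U n = V n)"
proof -
  have unique: "\<exists>!U. kink_solution \<omega> \<Phi>\<^sub>0 s U \<and> left_parameters \<omega> U A B"
    if "fps_nth A 0 = 0" "fps_nth B 0 = 0" for A B
  proof (rule ex_ex1I)
    show "\<exists>U. kink_solution \<omega> \<Phi>\<^sub>0 s U \<and> left_parameters \<omega> U A B"
      by (rule kink_solution_exists[OF that])
    fix U V
    assume U: "kink_solution \<omega> \<Phi>\<^sub>0 s U \<and> left_parameters \<omega> U A B"
      and V: "kink_solution \<omega> \<Phi>\<^sub>0 s V \<and> left_parameters \<omega> V A B"
    \<comment> \<open>Equal parameters determine each order from the earlier ones, which agree by
      the induction hypothesis.\<close>
    have "U n = V n" for n
      by (induction n rule: less_induct) (use U V kink_solution_determined in blast)
    then show "U = V" by blast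
  qed
  have determined: "U n = V n" if "kink_solution \<omega> \<Phi>\<^sub>0 s U \<and> left_parameters \<omega> U A B \<and>
      kink_solution \<omega> \<Phi>\<^sub>0 s V \<and> left_parameters \<omega> V A' B' \<and>
      (\<forall>k<n. U k = V k) \<and> fps_nth A n = fps_nth A' n \<and> fps_nth B n = fps_nth B' n" for U V A B A' B' n
    using that by (intro kink_solution_determined[of \<omega> \<Phi>\<^sub>0 s U A B V A' B' n]) blast+
  show ?thesis
    by (intro conjI allI impI)
      (erule conjE, rule unique, assumption+, rule kink_solution_valid, assumption,
        rule left_parameters_exists_unique, assumption, rule determined, assumption)
qed

end
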